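(* Let $d\ge1$ be an integer and $\beta\in(0,d]$. Suppose $\mu\in M_b(\mathbb{R}^d)$ is such that for some finite collection $\mathcal{F}\subset \mathbb{Z}_+\times \mathbb{Z}_+$ (of Schwartz seminorms) we have $\mathrm{M}_{\mathcal{F},d-\beta}\, \mu\in L^1(\mathcal{H}_\infty^\beta)$. Then $\dim_{\mathcal{H}} \mu \geq \beta$.
   Context: $M_b(\mathbb{R}^d)$ is the space of finite (signed) Radon measures on $\mathbb{R}^d$; $|\mu|$ is the total variation measure. Fractional grand maximal function: a finite collection $\mathcal{F}\subset\mathbb{Z}_+\times\mathbb{Z}_+$ indexes the Schwartz seminorms $\|\Phi\|_{p,q}=\sup_{x\in\mathbb{R}^d,\,|\gamma|\le q}(1+|x|)^p|\partial^\gamma\Phi(x)|$, $(p,q)\in\mathcal{F}$; $\|\Phi\|_{\mathcal{F}}=\max_{(p,q)\in\mathcal{F}}\|\Phi\|_{p,q}$. With $\Phi_t(x)=t^{-d}\Phi(x/t)$, for a tempered distribution $f$ and $\gamma\in[0,d]$, $$\mathrm{M}_{\mathcal{F},\gamma}f(x)=\sup\{t^\gamma|f*\Phi_t(x)| : t>0,\ \Phi\in\mathcal{S}(\mathbb{R}^d),\ \|\Phi\|_{\mathcal{F}}\le1\}.$$ Hausdorff content: $\mathcal{H}_\infty^\beta(E)=\inf\{\sum_i\omega_\beta r_i^\beta: E\subset\bigcup_iB(x_i,r_i)\}$ (countable covers by balls), $\omega_\beta=\pi^{\beta/2}/\Gamma(\beta/2+1)$. $L^1(\mathcal{H}_\infty^\beta)$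 is the space of $\mathcal{H}_\infty^\beta$-quasicontinuous functions $f$ (for every $\varepsilon>0$ there is an open set $O$ with $\mathcal{H}^\beta_\infty(O)<\varepsilon$ such that $f|_{\mathbb{R}^d\setminus O}$ is continuous) for which the Choquet integral $\int_{\mathbb{R}^d}|f|\,d\mathcal{H}_\infty^\beta=\int_0^\infty\mathcal{H}_\infty^\beta(\{|f|>t\})\,dt$ is finite. Lower Hausdorff dimension of a measure: $\dim_{\mathcal{H}}\mu=\sup\{\beta\in(0,d]: \mathcal{H}^\beta(E)=0 \implies |\mu|(E)=0\}$ (the implication being required for all Borel sets $E$), where $\mathcal{H}^\beta$ is Hausdorff measure. *)

theory Defs
  imports "HOL-Analysis.Analysis"
begin

text \<open>
  A finite signed Borel measure is a real-valued countably additive function on the Borel sets;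
  its values on non-Borel sets are irrelevant.  On a Euclidean space every such measure is Radon.
\<close>

definition signed_measure :: "('a::topological_space set \<Rightarrow> real) \<Rightarrow> bool" where
  "signed_measure \<mu> \<longleftrightarrow>
     \<mu> {} = 0 \<and>
     (\<forall>A :: nat \<Rightarrow> 'a set. range A \<subseteq> sets borel \<longrightarrow> disjoint_family A \<longrightarrow>
        (\<lambda>i. \<mu> (A i)) sums \<mu> (\<Union>i. A i))"

definition total_variation :: "('a::topological_space set \<Rightarrow> real) \<Rightarrow> 'a set \<Rightarrow> ennreal" where
  "total_variation \<mu> E =
     (SUP P \<in> {P. finite P \<and> disjoint P \<and> P \<subseteq> sets borel \<and> \<Union>P = E}. \<Sum>A\<in>P. ennreal \<bar>\<mu> A\<bar>)"

text \<open>
  The positive part of the Jordan decomposition is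
  \<open>\<mu>\<^sup>+(E) = sup {\<mu>(A) | A \<subseteq> E Borel}\<close>; the negative part is the positive part of \<open>- \<mu>\<close>.
  Since \<open>A = {}\<close> is admitted, the truncation of negative values by \<^const>\<open>ennreal\<close> is harmless.
\<close>

definition positive_part :: "('a::topological_space set \<Rightarrow> real) \<Rightarrow> 'a measure" where
  "positive_part \<mu> =
     measure_of UNIV (sets borel) (\<lambda>E. SUP A \<in> {A \<in> sets borel. A \<subseteq> E}. ennreal (\<mu> A))"

definition negative_part :: "('a::topological_space set \<Rightarrow> real) \<Rightarrow> 'a measure" where
  "negative_part \<mu> = positive_part (\<lambda>E. - \<mu> E)"

definition signed_integral ::
    "('a::topological_space set \<Rightarrow> real) \<Rightarrow> ('a \<Rightarrow> complex) \<Rightarrow> complex" where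
  "signed_integral \<mu> f =
     integral\<^sup>L (positive_part \<mu>) f - integral\<^sup>L (negative_part \<mu>) f"

lemma sets_positive_part [simp]: "sets (positive_part \<mu>) = sets borel"
  by (simp add: positive_part_def) (metis sets.sigma_sets_eq space_borel)

lemma space_positive_part [simp]: "space (positive_part \<mu>) = UNIV"
  by (simp add: positive_part_def)

lemma signed_measure_uminus: "signed_measure \<mu> \<Longrightarrow> signed_measure (\<lambda>E. - \<mu> E)"
  by (auto simp: signed_measure_def intro!: sums_minus)

text \<open>The set function in \<^const>\<open>positive_part\<close> is a measure, so \<^const>\<open>measure_of\<close> does not
  fall back to the zero measure.\<close>

lemma emeasure_positive_part:
  assumes \<mu>: "signed_measure \<mu>" and E: "E \<in> sets borel"
  shows "emeasure (positive_part \<mu>) E = (SUP A \<in> {A \<in> sets borel. A \<subseteq> E}. ennreal (\<mu> A))"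
proof -
  let ?v = "\<lambda>E. SUP A \<in> {A \<in> sets borel. A \<subseteq> E}. ennreal (\<mu> A)"
  have sums: "(\<lambda>i. \<mu> (A i)) sums \<mu> (\<Union>i. A i)"
    if "range A \<subseteq> sets borel" "disjoint_family A" for A :: "nat \<Rightarrow> 'a set"
    using \<mu> that by (auto simp: signed_measure_def)
  have emp: "\<mu> {} = 0" using \<mu> by (simp add: signed_measure_def)
  have un: "\<mu> (A \<union> B) = \<mu> A + \<mu> B"
    if "A \<in> sets borel" "B \<in> sets borel" "A \<inter> B = {}" for A B
  proof -
    have "(\<lambda>i. \<mu> (binaryset A B i)) sums \<mu> (\<Union>i. binaryset A B i)"
      by (rule sums) (use that in \<open>auto simp: range_binaryset_eq disjoint_family_on_def binaryset_def\<close>)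
    moreover have "(\<lambda>i. \<mu> (binaryset A B i)) sums (\<mu> A + \<mu> B)"
      by (rule binaryset_sums) (rule emp)
    ultimately show ?thesis by (simp add: UN_binaryset_eq sums_unique2)
  qed
  have ne: "{A \<in> sets borel. A \<subseteq> E} \<noteq> {}" for E :: "'a set" by auto
  have super: "?v A + ?v B \<le> ?v (A \<union> B)"
    if AB: "A \<in> sets borel" "B \<in> sets borel" "A \<inter> B = {}" for A B
  proof -
    have st: "ennreal (\<mu> S) + ennreal (\<mu> T) \<le> ?v (A \<union> B)"
      if S: "S \<in> sets borel" "S \<subseteq> A" and T: "T \<in> sets borel" "T \<subseteq> B" for S T
    proof -
      define S' where "S' = (if \<mu> S < 0 then {} else S)"
      define T' where "T' = (if \<mu> T < 0 then {} else T)"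
      have sub: "S' \<in> sets borel" "T' \<in> sets borel" "S' \<inter> T' = {}" "S' \<union> T' \<subseteq> A \<union> B"
        using S T AB by (auto simp: S'_def T'_def)
      have "ennreal (\<mu> S) + ennreal (\<mu> T) = ennreal (\<mu> S') + ennreal (\<mu> T')"
        by (auto simp: S'_def T'_def emp ennreal_neg)
      also have "\<dots> = ennreal (\<mu> (S' \<union> T'))"
        using un[OF sub(1-3)] by (auto simp: S'_def T'_def emp simp flip: ennreal_plus)
      also have "\<dots> \<le> ?v (A \<union> B)"
        by (rule SUP_upper) (use sub in auto)
      finally show ?thesis .
    qed
    have l: "?v A + ennreal (\<mu> T) \<le> ?v (A \<union> B)" if T: "T \<in> sets borel" "T \<subseteq> B" for T
      by (rule ord_eq_le_trans[OF ennreal_SUP_add_left[OF ne, symmetric] SUP_least])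
         (use st T in blast)
    show ?thesis
      by (rule ord_eq_le_trans[OF ennreal_SUP_add_right[OF ne] SUP_least]) (use l in blast)
  qed
  have mono: "?v A \<le> ?v B" if "A \<subseteq> B" for A B
    by (rule SUP_subset_mono) (use that in auto)
  have ca: "countably_additive (sets borel) ?v"
  proof (rule countably_additiveI)
    fix A :: "nat \<Rightarrow> 'a set"
    assume A: "range A \<subseteq> sets borel" "disjoint_family A" "(\<Union>i. A i) \<in> sets borel"
    have part: "(\<Sum>i<n. ?v (A i)) \<le> ?v (\<Union>i<n. A i)" for n
    proof (induction n)
      case 0 then show ?case by simp
    next
      case (Suc n)
      have "(\<Sum>i<Suc n. ?v (A i)) \<le> ?v (\<Union>i<n. A i) + ?v (A n)"
        using Suc by (simp add: add_right_mono)
      also have "\<dots> \<le> ?v ((\<Union>i<n. A i) \<union> A n)"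
      proof (rule super)
        have "A i \<inter> A n = {}" if "i < n" for i
          using A(2) that by (intro disjoint_family_onD[where I = UNIV and A = A]) auto
        then show "(\<Union>i<n. A i) \<inter> A n = {}" by blast
        show "(\<Union>i<n. A i) \<in> sets borel" "A n \<in> sets borel" using A(1) by auto
      qed
      also have "(\<Union>i<n. A i) \<union> A n = (\<Union>i<Suc n. A i)" by (auto simp: less_Suc_eq)
      finally show ?case .
    qed
    have "(\<Sum>i. ?v (A i)) \<le> ?v (\<Union>i. A i)"
      unfolding suminf_eq_SUP by (rule SUP_least, rule order_trans[OF part mono]) auto
    moreover have "?v (\<Union>i. A i) \<le> (\<Sum>i. ?v (A i))"
    proof (rule SUP_least)
      fix S assume "S \<in> {S \<in> sets borel. S \<subseteq> (\<Union>i. A i)}"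
      then have S: "S \<in> sets borel" "S \<subseteq> (\<Union>i. A i)" by auto
      have "(\<lambda>i. \<mu> (S \<inter> A i)) sums \<mu> (\<Union>i. S \<inter> A i)"
        by (rule sums) (use A S in \<open>auto simp: disjoint_family_on_def\<close>)
      also have "(\<Union>i. S \<inter> A i) = S" using S by auto
      finally have lim: "(\<lambda>n. ennreal (\<Sum>i<n. \<mu> (S \<inter> A i))) \<longlonglongrightarrow> ennreal (\<mu> S)"
        by (intro tendsto_ennrealI) (simp add: sums_def)
      have "ennreal (\<Sum>i<n. \<mu> (S \<inter> A i)) \<le> (\<Sum>i. ?v (A i))" for n
      proof -
        have "ennreal (\<Sum>i<n. \<mu> (S \<inter> A i)) \<le> ennreal (\<Sum>i<n. max 0 (\<mu> (S \<inter> A i)))"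
          by (intro ennreal_leI sum_mono) auto
        also have "\<dots> = (\<Sum>i<n. ennreal (max 0 (\<mu> (S \<inter> A i))))" by simp
        also have "\<dots> \<le> (\<Sum>i<n. ?v (A i))"
        proof (rule sum_mono)
          fix i
          have "ennreal (\<mu> (S \<inter> A i)) \<le> ?v (A i)"
            by (rule SUP_upper) (use A S in auto)
          then show "ennreal (max 0 (\<mu> (S \<inter> A i))) \<le> ?v (A i)"
            by (simp add: max_def ennreal_neg split: if_splits)
        qed
        also have "\<dots> \<le> (\<Sum>i. ?v (A i))"
          unfolding suminf_eq_SUP by (rule SUP_upper) simp
        finally show ?thesis .
      qed
      then show "ennreal (\<mu> S) \<le> (\<Sum>i. ?v (A i))"
        by (intro LIMSEQ_le_const2[OF lim]) auto
    qed
    ultimately show "(\<Sum>i. ?v (A i)) = ?v (\<Union>i. A i)" by (rule antisym)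
  qed
  have pos: "positive (sets borel) ?v"
    by (auto simp: positive_def emp cong: conj_cong)
  show ?thesis
  proof (rule emeasure_measure_of[OF positive_part_def])
    show "sets borel \<subseteq> Pow UNIV" by simp
  qed (use pos ca E in auto)
qed

text \<open>
  Iterated partial derivatives along a list of basis vectors.  For smooth functions the order of the
  list is irrelevant, so lists of length \<open>k\<close> play the role of multi-indices of order \<open>k\<close>.
\<close>

primrec iterated_partial ::
    "'a::euclidean_space list \<Rightarrow> ('a \<Rightarrow> 'b::real_normed_vector) \<Rightarrow> 'a \<Rightarrow> 'b" where
  "iterated_partial [] f = f"
| "iterated_partial (b # bs) f = (\<lambda>x. frechet_derivative (iterated_partial bs f) (at x) b)"

text \<open>Differentiability of all iterated partial derivatives is equivalent to being \<open>C\<^sup>\<infinity>\<close>.\<close>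

definition smooth :: "('a::euclidean_space \<Rightarrow> 'b::real_normed_vector) \<Rightarrow> bool" where
  "smooth f \<longleftrightarrow>
     (\<forall>bs x. set bs \<subseteq> Basis \<longrightarrow> iterated_partial bs f differentiable (at x))"

definition schwartz_seminorm ::
    "nat \<Rightarrow> nat \<Rightarrow> ('a::euclidean_space \<Rightarrow> complex) \<Rightarrow> ennreal" where
  "schwartz_seminorm p q \<Phi> =
     (SUP (x, bs) \<in> UNIV \<times> {bs. set bs \<subseteq> Basis \<and> length bs \<le> q}.
        ennreal ((1 + norm x) ^ p * norm (iterated_partial bs \<Phi> x)))"

definition schwartz :: "('a::euclidean_space \<Rightarrow> complex) \<Rightarrow> bool" where
  "schwartz \<Phi> \<longleftrightarrow> smooth \<Phi> \<and> (\<forall>p q. schwartz_seminorm p q \<Phi> < \<infinity>)"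

text \<open>The supremum is a maximum for finite nonempty \<open>F\<close>, and \<open>0\<close> for empty \<open>F\<close>.\<close>

definition schwartz_norm ::
    "(nat \<times> nat) set \<Rightarrow> ('a::euclidean_space \<Rightarrow> complex) \<Rightarrow> ennreal" where
  "schwartz_norm F \<Phi> = (SUP (p, q) \<in> F. schwartz_seminorm p q \<Phi>)"

definition dilation :: "real \<Rightarrow> ('a::euclidean_space \<Rightarrow> complex) \<Rightarrow> 'a \<Rightarrow> complex" where
  "dilation t \<Phi> x = complex_of_real (inverse (t ^ DIM('a))) * \<Phi> (x /\<^sub>R t)"

text \<open>Tempered distributions are functionals on Schwartz functions;
  \<open>(T * \<phi>)(x) = T (\<phi>(x - \<cdot>))\<close>, and a measure acts by integration.\<close>

definition distribution_of ::
    "('a::euclidean_space set \<Rightarrow> real) \<Rightarrow> ('a \<Rightarrow> complex) \<Rightarrow> complex" where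
  "distribution_of \<mu> \<phi> = signed_integral \<mu> \<phi>"

definition convolution ::
    "(('a::euclidean_space \<Rightarrow> complex) \<Rightarrow> complex) \<Rightarrow> ('a \<Rightarrow> complex) \<Rightarrow> 'a \<Rightarrow> complex" where
  "convolution T \<phi> x = T (\<lambda>y. \<phi> (x - y))"

definition grand_maximal ::
    "(nat \<times> nat) set \<Rightarrow> real \<Rightarrow> (('a::euclidean_space \<Rightarrow> complex) \<Rightarrow> complex) \<Rightarrow> 'a \<Rightarrow> ereal" where
  "grand_maximal F \<gamma> T x =
     (SUP (t, \<Phi>) \<in> {0<..} \<times> {\<Phi>. schwartz \<Phi> \<and> schwartz_norm F \<Phi> \<le> 1}.
        ereal (t powr \<gamma> * norm (convolution T (dilation t \<Phi>) x)))"

definition omega :: "real \<Rightarrow> real" where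
  "omega \<beta> = pi powr (\<beta> / 2) / Gamma (\<beta> / 2 + 1)"

text \<open>Below, \<open>\<beta> > 0\<close>, so that \<open>0 powr \<beta> = 0\<close> is the value wanted for an empty covering set;
  balls of radius \<open>0\<close> are empty, so that finite covers are included.\<close>

definition hausdorff_content :: "real \<Rightarrow> 'a::euclidean_space set \<Rightarrow> ennreal" where
  "hausdorff_content \<beta> E =
     (INF (x, r) \<in> {(x :: nat \<Rightarrow> 'a, r :: nat \<Rightarrow> real). (\<forall>i. 0 \<le> r i) \<and> E \<subseteq> (\<Union>i. ball (x i) (r i))}.
        \<Sum>i. ennreal (omega \<beta> * r i powr \<beta>))"

definition hausdorff_measure :: "real \<Rightarrow> 'a::euclidean_space set \<Rightarrow> ennreal" where
  "hausdorff_measure \<beta> E =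
     (SUP \<delta> \<in> {0<..}.
        INF C \<in> {C :: nat \<Rightarrow> 'a set. (\<forall>i. bounded (C i) \<and> diameter (C i) \<le> \<delta>) \<and> E \<subseteq> (\<Union>i. C i)}.
          \<Sum>i. ennreal (omega \<beta> * (diameter (C i) / 2) powr \<beta>))"

definition quasicontinuous :: "real \<Rightarrow> ('a::euclidean_space \<Rightarrow> ereal) \<Rightarrow> bool" where
  "quasicontinuous \<beta> f \<longleftrightarrow>
     (\<forall>\<epsilon>>0. \<exists>U. open U \<and> hausdorff_content \<beta> U < ennreal \<epsilon> \<and> continuous_on (UNIV - U) f)"

definition choquet_integral :: "real \<Rightarrow> ('a::euclidean_space \<Rightarrow> ereal) \<Rightarrow> ennreal" where
  "choquet_integral \<beta> f =
     (\<integral>\<^sup>+ t \<in> {0<..}. hausdorff_content \<beta> {x. ereal t < \<bar>f x\<bar>} \<partial>lborel)"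

text \<open>
  Functions may take infinite values, and continuity refers to the topology of \<^typ>\<open>ereal\<close>.  A
  function with finite Choquet integral is infinite only on a set of content zero, which is contained
  in open sets of arbitrarily small content, so that quasicontinuity in this sense agrees with
  quasicontinuity for finite-valued restrictions.
\<close>

definition L1_content :: "real \<Rightarrow> ('a::euclidean_space \<Rightarrow> ereal) set" where
  "L1_content \<beta> = {f. quasicontinuous \<beta> f \<and> choquet_integral \<beta> f < \<infinity>}"

text \<open>In \<^typ>\<open>ennreal\<close>, the supremum of the empty set is \<open>0\<close>.\<close>

definition lower_hausdorff_dim :: "('a::euclidean_space set \<Rightarrow> real) \<Rightarrow> ennreal" where
  "lower_hausdorff_dim \<mu> =
     (SUP \<beta> \<in> {\<beta>. 0 < \<beta> \<and> \<beta> \<le> real DIM('a) \<and>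
        (\<forall>E \<in> sets borel. hausdorff_measure \<beta> E = 0 \<longrightarrow> total_variation \<mu> E = 0)}. ennreal \<beta>)"

end

theory Submission
  imports Defs
begin

text \<open>
  Let \<open>M\<close> be the grand maximal function of \<open>\<mu>\<close> and \<open>d\<close> the dimension.  By inner regularity it suffices
  to show \<open>\<mu> K = 0\<close> for every compact \<open>K\<close> of Hausdorff content zero
  (\<open>compact_content_eq_0_imp_measure_eq_0\<close>).  Since \<open>\<mu>\<close> is signed and \<open>M\<close> only sees smooth averages,
  cubes cannot be measured directly; instead \<open>\<mu> K\<close> is the limit of \<open>\<integral>u d\<mu>\<close> for smooth cutoffs \<open>u\<close> of \<open>K\<close>
  that are sums of well-localized pieces.

  A smooth function living at scale \<open>l\<close> around a point \<open>y\<close>, that is, supported in a ball of radius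
  \<open>O(l)\<close> about \<open>y\<close> with derivatives of order \<open>m\<close> of size \<open>O(l\<^sup>-\<^sup>m)\<close>, is a constant times
  \<open>l\<^sup>d \<Phi>\<^sub>l(y - \<cdot>)\<close> for an admissible \<open>\<Phi>\<close>.  Hence its integral against \<open>\<mu>\<close> is \<open>O(l\<^sup>\<beta> M(y))\<close>
  (\<open>grand_maximal_controls_localized\<close>).  So a cutoff made of pieces at scales \<open>l\<^sub>j\<close>, each near a
  point where \<open>M \<le> t\<close>, has integral \<open>O(t \<Sum> l\<^sub>j\<^sup>\<beta>)\<close>, and two things remain.

  \<^item> \<^emph>\<open>Cubes with small \<open>t \<Sum> l\<^sub>j\<^sup>\<beta>\<close>.\<close>  Finiteness of the Choquet integral yields, for each \<open>\<epsilon>\<close>, a level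
    \<open>t \<ge> 1\<close> at which \<open>{M > t}\<close> has content below \<open>\<epsilon> / t\<close>, because \<open>1 / t\<close> is not integrable at infinity
    (\<open>choquet_integral_tail\<close>).  Cover \<open>K \<union> {M > t}\<close> by dyadic cubes of correspondingly small total
    \<open>\<Sum> l\<^sup>\<beta>\<close>.  A cube not contained in \<open>{M > t}\<close> already contains a point with \<open>M \<le> t\<close>.  The points of \<open>K\<close>
    met only by cubes inside \<open>{M > t}\<close> are covered by maximal dyadic cubes inside \<open>{M > t}\<close>: their
    parents meet \<open>{M \<le> t}\<close>, and since \<open>\<beta> \<le> d\<close> a cube covered by subcubes never has larger \<open>l\<^sup>\<beta>\<close> than these
    have in total (\<open>stopping_cubes\<close>).

  \<^item> \<^emph>\<open>A smooth partition adapted to cubes of very different sizes.\<close>  Process the scales from coarse to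
    fine: a cube at scale \<open>k\<close> receives the standard bumps of scale \<open>k\<close> times the product of
    \<open>1 - layer\<close> over all coarser scales.  The derivatives of that product stay comparable to those of a
    function of scale \<open>k\<close>, because the coarser contributions form a geometric sum
    (\<open>derivs_le_mult_growth\<close>).  This is the partition of unity of Harvey and Polking.
\<close>

section \<open>Functions with prescribed derivative bounds\<close>

text \<open>
  All derivatives up to order \<open>N + 1\<close> exist, up to order \<open>N\<close> they satisfy the bounds \<open>C\<close>, and only
  directions in the standard basis are differentiated.  The bounds depend on the point, so that an
  indicator function in \<open>C\<close> keeps track of supports.  The recursion peels off the innermost derivative, which
  makes the product rule a plain induction on \<open>N\<close>.
\<close>

primrec derivs_le :: "nat \<Rightarrow> (nat \<Rightarrow> 'a \<Rightarrow> real) \<Rightarrow> ('a::euclidean_space \<Rightarrow> real) \<Rightarrow> bool" where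
  "derivs_le 0 C f \<longleftrightarrow> (\<forall>x. f differentiable (at x) \<and> \<bar>f x\<bar> \<le> C 0 x)"
| "derivs_le (Suc N) C f \<longleftrightarrow> (\<forall>x. f differentiable (at x) \<and> \<bar>f x\<bar> \<le> C 0 x) \<and>
     (\<forall>b\<in>Basis. derivs_le N (\<lambda>m. C (Suc m)) (\<lambda>x. frechet_derivative f (at x) b))"

lemma derivs_le_differentiable: "derivs_le N C f \<Longrightarrow> f differentiable (at x)"
  by (cases N) auto

lemma derivs_le_bound: "derivs_le N C f \<Longrightarrow> \<bar>f x\<bar> \<le> C 0 x"
  by (cases N) auto

lemma derivs_le_SucI:
  assumes "\<And>x. (f has_derivative f' x) (at x)" and "\<And>x. \<bar>f x\<bar> \<le> C 0 x"
    and "\<And>b. b \<in> Basis \<Longrightarrow> derivs_le N (\<lambda>m. C (Suc m)) (\<lambda>x. f' x b)"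
  shows "derivs_le (Suc N) C f"
proof -
  have "frechet_derivative f (at x) = f' x" for x
    using assms(1) frechet_derivative_at by metis
  then show ?thesis
    using assms by (auto simp: differentiable_def)
qed

lemma derivs_le_SucE:
  assumes "derivs_le (Suc N) C f"
  obtains f' where "\<And>x. (f has_derivative f' x) (at x)"
    "\<And>b. b \<in> Basis \<Longrightarrow> derivs_le N (\<lambda>m. C (Suc m)) (\<lambda>x. f' x b)"
proof
  show "(f has_derivative frechet_derivative f (at x)) (at x)" for x
    using derivs_le_differentiable[OF assms] frechet_derivative_works by blast
qed (use assms in auto)

lemma derivs_le_mono:
  assumes "derivs_le N C f" and "\<And>m x. C m x \<le> D m x"
  shows "derivs_le N D f"
  using assms
proof (induction N arbitrary: C D f)
  case 0
  have "\<bar>f x\<bar> \<le> D 0 x" for x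
    using derivs_le_bound[OF 0(1), of x] 0(2)[of 0 x] by linarith
  with 0 show ?case by simp
next
  case (Suc N)
  have "derivs_le N (\<lambda>m. D (Suc m)) (\<lambda>x. frechet_derivative f (at x) b)" if "b \<in> Basis" for b
    by (rule Suc.IH[of "\<lambda>m. C (Suc m)"]) (use Suc.prems that in auto)
  moreover have "\<bar>f x\<bar> \<le> D 0 x" for x
    using derivs_le_bound[OF Suc.prems(1), of x] Suc.prems(2)[of 0 x] by linarith
  ultimately show ?case using Suc.prems(1) by simp
qed

lemma derivs_le_const: "derivs_le N (\<lambda>m x. if m = 0 then \<bar>c\<bar> else 0) (\<lambda>x. c)"
proof (induction N arbitrary: c)
  case 0
  then show ?case by simp
next
  case (Suc N)
  show ?case
    by (rule derivs_le_SucI[where f'="\<lambda>_ _. 0"])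
       (auto intro: derivs_le_mono[OF Suc.IH[of 0]])
qed

lemma derivs_le_add:
  assumes "derivs_le N C f" "derivs_le N D g"
  shows "derivs_le N (\<lambda>m x. C m x + D m x) (\<lambda>x. f x + g x)"
  using assms
proof (induction N arbitrary: C D f g)
  case 0
  have "\<bar>f x + g x\<bar> \<le> C 0 x + D 0 x" for x
    using derivs_le_bound[OF 0(1), of x] derivs_le_bound[OF 0(2), of x] by linarith
  with 0 show ?case by simp
next
  case (Suc N)
  obtain f' where f: "\<And>x. (f has_derivative f' x) (at x)"
    "\<And>b. b \<in> Basis \<Longrightarrow> derivs_le N (\<lambda>m. C (Suc m)) (\<lambda>x. f' x b)"
    using derivs_le_SucE[OF Suc.prems(1)] by blast
  obtain g' where g: "\<And>x. (g has_derivative g' x) (at x)"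
    "\<And>b. b \<in> Basis \<Longrightarrow> derivs_le N (\<lambda>m. D (Suc m)) (\<lambda>x. g' x b)"
    using derivs_le_SucE[OF Suc.prems(2)] by blast
  show ?case
  proof (rule derivs_le_SucI[where f'="\<lambda>x h. f' x h + g' x h"])
    show "((\<lambda>x. f x + g x) has_derivative (\<lambda>h. f' x h + g' x h)) (at x)" for x
      by (intro has_derivative_add f g)
    show "\<bar>f x + g x\<bar> \<le> C 0 x + D 0 x" for x
      using derivs_le_bound[OF Suc.prems(1), of x] derivs_le_bound[OF Suc.prems(2), of x] by linarith
  qed (rule Suc.IH[OF f(2) g(2)])
qed

lemma derivs_le_minus:
  assumes "derivs_le N C f"
  shows "derivs_le N C (\<lambda>x. - f x)"
  using assms
proof (induction N arbitrary: C f)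
  case 0
  then show ?case by auto
next
  case (Suc N)
  obtain f' where f: "\<And>x. (f has_derivative f' x) (at x)"
    "\<And>b. b \<in> Basis \<Longrightarrow> derivs_le N (\<lambda>m. C (Suc m)) (\<lambda>x. f' x b)"
    using derivs_le_SucE[OF Suc.prems(1)] by blast
  show ?case
    by (rule derivs_le_SucI[where f'="\<lambda>x h. - f' x h"])
       (use f Suc.IH derivs_le_bound[OF Suc.prems(1)] in \<open>auto intro: has_derivative_minus\<close>)
qed

lemma derivs_le_sum:
  assumes "finite I" "\<And>i. i \<in> I \<Longrightarrow> derivs_le N (C i) (f i)"
  shows "derivs_le N (\<lambda>m x. \<Sum>i\<in>I. C i m x) (\<lambda>x. \<Sum>i\<in>I. f i x)"
  using assms
proof (induction I rule: finite_induct)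
  case empty
  show ?case using derivs_le_const[of N 0] by (simp cong: if_cong)
next
  case (insert i I)
  then show ?case by (simp add: derivs_le_add)
qed

definition leibniz :: "(nat \<Rightarrow> 'a \<Rightarrow> real) \<Rightarrow> (nat \<Rightarrow> 'a \<Rightarrow> real) \<Rightarrow> nat \<Rightarrow> 'a \<Rightarrow> real" where
  "leibniz C D m x = (\<Sum>j\<le>m. real (m choose j) * C j x * D (m - j) x)"

lemma leibniz_Suc:
  "leibniz C D (Suc m) x = leibniz (\<lambda>j. C (Suc j)) D m x + leibniz C (\<lambda>j. D (Suc j)) m x"
proof -
  let ?T = "\<lambda>c j. real c * C j x * D (Suc m - j) x"
  have "leibniz C D (Suc m) x = ?T 1 0 + (\<Sum>j\<le>m. ?T (Suc m choose Suc j) (Suc j))"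
    unfolding leibniz_def by (subst sum.atMost_Suc_shift) simp
  also have "(\<Sum>j\<le>m. ?T (Suc m choose Suc j) (Suc j)) =
      (\<Sum>j\<le>m. ?T (m choose j) (Suc j)) + (\<Sum>j\<le>m. ?T (m choose Suc j) (Suc j))"
    by (simp add: algebra_simps sum.distrib)
  also have "(\<Sum>j\<le>m. ?T (m choose j) (Suc j)) = leibniz (\<lambda>j. C (Suc j)) D m x"
    by (simp add: leibniz_def)
  also have "?T 1 0 + (leibniz (\<lambda>j. C (Suc j)) D m x + (\<Sum>j\<le>m. ?T (m choose Suc j) (Suc j))) =
     leibniz (\<lambda>j. C (Suc j)) D m x + (\<Sum>j\<le>Suc m. ?T (m choose j) j)"
    by (subst sum.atMost_Suc_shift) simp
  also have "(\<Sum>j\<le>Suc m. ?T (m choose j) j) = leibniz C (\<lambda>j. D (Suc j)) m x"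
    unfolding leibniz_def by (auto simp: Suc_diff_le intro!: sum.cong)
  finally show ?thesis .
qed

lemma derivs_le_mult:
  assumes "derivs_le N C f" "derivs_le N D g"
  shows "derivs_le N (leibniz C D) (\<lambda>x. f x * g x)"
  using assms
proof (induction N arbitrary: C D f g)
  case 0
  have "\<bar>f x * g x\<bar> \<le> leibniz C D 0 x" for x
    using mult_mono'[OF derivs_le_bound[OF 0(1), of x] derivs_le_bound[OF 0(2), of x]]
    by (simp add: leibniz_def abs_mult)
  with 0 show ?case by simp
next
  case (Suc N)
  have le: "derivs_le N C f" if "derivs_le (Suc N) C f" for C and f :: "'a \<Rightarrow> real"
    using that by (induction N arbitrary: C f) auto
  obtain f' where f: "\<And>x. (f has_derivative f' x) (at x)"
    "\<And>b. b \<in> Basis \<Longrightarrow> derivs_le N (\<lambda>m. C (Suc m)) (\<lambda>x. f' x b)"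
    using derivs_le_SucE[OF Suc.prems(1)] by blast
  obtain g' where g: "\<And>x. (g has_derivative g' x) (at x)"
    "\<And>b. b \<in> Basis \<Longrightarrow> derivs_le N (\<lambda>m. D (Suc m)) (\<lambda>x. g' x b)"
    using derivs_le_SucE[OF Suc.prems(2)] by blast
  show ?case
  proof (rule derivs_le_SucI[where f'="\<lambda>x h. f' x h * g x + f x * g' x h"])
    show "((\<lambda>x. f x * g x) has_derivative (\<lambda>h. f' x h * g x + f x * g' x h)) (at x)" for x
      using has_derivative_mult[OF f(1) g(1), of x] by (simp add: algebra_simps)
    show "\<bar>f x * g x\<bar> \<le> leibniz C D 0 x" for x
      using mult_mono'[OF derivs_le_bound[OF Suc.prems(1), of x] derivs_le_bound[OF Suc.prems(2), of x]]
      by (simp add: leibniz_def abs_mult)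
    show "derivs_le N (\<lambda>m. leibniz C D (Suc m)) (\<lambda>x. f' x b * g x + f x * g' x b)"
      if b: "b \<in> Basis" for b
      unfolding leibniz_Suc[abs_def]
      by (intro derivs_le_add Suc.IH f(2) g(2) b le Suc.prems)
  qed
qed

lemma derivs_le_cmult:
  assumes "derivs_le N C f"
  shows "derivs_le N (\<lambda>m x. \<bar>c\<bar> * C m x) (\<lambda>x. c * f x)"
proof -
  have "leibniz (\<lambda>m x. if m = 0 then \<bar>c\<bar> else 0) C m x = \<bar>c\<bar> * C m x" for m x
  proof -
    have "leibniz (\<lambda>m x. if m = 0 then \<bar>c\<bar> else 0) C m x =
        (\<Sum>j\<in>{0}. real (m choose j) * (if j = 0 then \<bar>c\<bar> else 0) * C (m - j) x)"
      unfolding leibniz_def by (rule sum.mono_neutral_right) auto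
    then show ?thesis by simp
  qed
  then show ?thesis
    by (intro derivs_le_mono[OF derivs_le_mult[OF derivs_le_const assms, of c]]) simp
qed

text \<open>
  Rescaling by \<open>s\<close> costs a factor \<open>\<bar>s\<bar>\<close> for each derivative; this is how functions of scale \<open>2\<^sup>-\<^sup>k\<close> arise
  from one fixed profile.
\<close>

lemma derivs_le_affine:
  assumes "derivs_le N C f"
  shows "derivs_le N (\<lambda>m x. \<bar>s\<bar> ^ m * C m (s *\<^sub>R x + a)) (\<lambda>x. f (s *\<^sub>R x + a))"
  using assms
proof (induction N arbitrary: C f)
  case 0
  have "(\<lambda>x. f (s *\<^sub>R x + a)) differentiable (at x)" for x
    using 0 by (intro differentiable_compose[of f "\<lambda>x. s *\<^sub>R x + a"]) auto
  with 0 show ?case by auto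
next
  case (Suc N)
  obtain f' where f: "\<And>x. (f has_derivative f' x) (at x)"
    "\<And>b. b \<in> Basis \<Longrightarrow> derivs_le N (\<lambda>m. C (Suc m)) (\<lambda>x. f' x b)"
    using derivs_le_SucE[OF Suc.prems(1)] by blast
  show ?case
  proof (rule derivs_le_SucI[where f'="\<lambda>x h. s * f' (s *\<^sub>R x + a) h"])
    fix x
    have "((\<lambda>x. f (s *\<^sub>R x + a)) has_derivative (\<lambda>h. f' (s *\<^sub>R x + a) (s *\<^sub>R h))) (at x)"
      by (rule has_derivative_compose[OF _ f(1)]) (auto intro!: derivative_eq_intros)
    then show "((\<lambda>x. f (s *\<^sub>R x + a)) has_derivative (\<lambda>h. s * f' (s *\<^sub>R x + a) h)) (at x)"
      using linear_cmul[OF has_derivative_linear[OF f(1)]] by simp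
    show "\<bar>f (s *\<^sub>R x + a)\<bar> \<le> \<bar>s\<bar> ^ 0 * C 0 (s *\<^sub>R x + a)"
      using derivs_le_bound[OF Suc.prems] by simp
  next
    fix b :: 'a assume "b \<in> Basis"
    from derivs_le_cmult[OF Suc.IH[OF f(2)[OF this]], of s]
    show "derivs_le N (\<lambda>m x. \<bar>s\<bar> ^ Suc m * C (Suc m) (s *\<^sub>R x + a)) (\<lambda>x. s * f' (s *\<^sub>R x + a) b)"
      by (simp add: mult.assoc)
  qed
qed

lemma derivs_le_coordinate:
  assumes "derivs_le N C f" and i: "i \<in> Basis" and "\<And>m s. 0 \<le> C m s"
  shows "derivs_le N (\<lambda>m x. C m (x \<bullet> i)) (\<lambda>x. f (x \<bullet> i))"
  using assms(1,3)
proof (induction N arbitrary: C f)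
  case 0
  have "(\<lambda>x. f (x \<bullet> i)) differentiable (at x)" for x
    using 0 by (intro differentiable_compose[of f "\<lambda>x. x \<bullet> i"])
      (auto intro!: bounded_linear_imp_differentiable bounded_linear_inner_left)
  with 0 show ?case by auto
next
  case (Suc N)
  obtain f' where f: "\<And>x. (f has_derivative f' x) (at x)"
    "\<And>b. b \<in> Basis \<Longrightarrow> derivs_le N (\<lambda>m. C (Suc m)) (\<lambda>x. f' x b)"
    using derivs_le_SucE[OF Suc.prems(1)] by blast
  show ?case
  proof (rule derivs_le_SucI[where f'="\<lambda>x h. (h \<bullet> i) * f' (x \<bullet> i) 1"])
    fix x
    have "((\<lambda>x. f (x \<bullet> i)) has_derivative (\<lambda>h. f' (x \<bullet> i) (h \<bullet> i))) (at x)"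
      by (rule has_derivative_compose[OF _ f(1)]) (auto intro!: derivative_eq_intros)
    moreover have "f' (x \<bullet> i) (h \<bullet> i) = (h \<bullet> i) * f' (x \<bullet> i) 1" for h
      using linear_cmul[OF has_derivative_linear[OF f(1)], of "x \<bullet> i" "h \<bullet> i" 1]
      by (simp del: mult_cancel_right1)
    ultimately show "((\<lambda>x. f (x \<bullet> i)) has_derivative (\<lambda>h. (h \<bullet> i) * f' (x \<bullet> i) 1)) (at x)"
      by (metis (no_types, lifting) ext)
    show "\<bar>f (x \<bullet> i)\<bar> \<le> C 0 (x \<bullet> i)"
      using derivs_le_bound[OF Suc.prems(1)] by simp
  next
    fix b :: 'a assume b: "b \<in> Basis"
    have "derivs_le N (\<lambda>m x. C (Suc m) (x \<bullet> i)) (\<lambda>x. f' (x \<bullet> i) 1)"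
      by (rule Suc.IH[of "\<lambda>m. C (Suc m)" "\<lambda>s. f' s 1"]) (use f(2)[of 1] Suc.prems in auto)
    from derivs_le_cmult[OF this, of "b \<bullet> i"]
    show "derivs_le N (\<lambda>m x. C (Suc m) (x \<bullet> i)) (\<lambda>x. (b \<bullet> i) * f' (x \<bullet> i) 1)"
      by (rule derivs_le_mono) (use b i Suc.prems(2) in \<open>auto simp: inner_Basis\<close>)
  qed
qed

text \<open>
  \<^const>\<open>iterated_partial\<close> adds derivatives from the outside, \<open>derivs_le\<close> peels them off from the inside;
  appending at the end of the list mediates between the two.
\<close>

lemma iterated_partial_snoc:
  "iterated_partial (bs @ [b]) f = iterated_partial bs (\<lambda>x. frechet_derivative f (at x) b)"
  by (induction bs) auto

lemma derivs_le_iterated_partial: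
  assumes "derivs_le N C f" "set bs \<subseteq> Basis" "length bs \<le> N"
  shows "iterated_partial bs f differentiable (at x)"
    and "\<bar>iterated_partial bs f x\<bar> \<le> C (length bs) x"
proof -
  have "\<forall>x. iterated_partial bs f differentiable (at x) \<and> \<bar>iterated_partial bs f x\<bar> \<le> C (length bs) x"
    using assms
  proof (induction N arbitrary: C f bs)
    case 0
    then show ?case by simp
  next
    case (Suc N)
    show ?case
    proof (cases bs rule: rev_cases)
      case Nil
      then show ?thesis using Suc.prems by simp
    next
      case (snoc bs' b)
      have "derivs_le N (\<lambda>m. C (Suc m)) (\<lambda>x. frechet_derivative f (at x) b)"
        using Suc.prems snoc by auto
      from Suc.IH[OF this, of bs'] Suc.prems snoc
      show ?thesis by (simp add: iterated_partial_snoc)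
    qed
  qed
  then show "iterated_partial bs f differentiable (at x)"
    and "\<bar>iterated_partial bs f x\<bar> \<le> C (length bs) x" by auto
qed

lemma iterated_partial_of_real:
  assumes "\<And>N. derivs_le N C f" "set bs \<subseteq> Basis"
  shows "iterated_partial bs (\<lambda>x. complex_of_real (f x)) = (\<lambda>x. complex_of_real (iterated_partial bs f x))"
  using assms(2)
proof (induction bs)
  case Nil
  then show ?case by simp
next
  case (Cons b bs)
  have "((\<lambda>x. complex_of_real (iterated_partial bs f x)) has_derivative
        (\<lambda>h. complex_of_real (frechet_derivative (iterated_partial bs f) (at x) h))) (at x)" for x
  proof (rule has_derivative_of_real)
    show "(iterated_partial bs f has_derivative frechet_derivative (iterated_partial bs f) (at x)) (at x)"
      using derivs_le_iterated_partial(1)[OF assms(1) _ order_refl, of bs x] Cons.prems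
        frechet_derivative_works by auto
  qed
  then have "frechet_derivative (\<lambda>x. complex_of_real (iterated_partial bs f x)) (at x) =
     (\<lambda>h. complex_of_real (frechet_derivative (iterated_partial bs f) (at x) h))" for x
    using frechet_derivative_at by metis
  with Cons show ?case by simp
qed

section \<open>A smooth partition of unity on the line\<close>

lemma leibniz_indicator:
  "leibniz (\<lambda>m x. c m * indicator U x) (\<lambda>m x. e m * indicator V x) =
     (\<lambda>m x. (\<Sum>j\<le>m. real (m choose j) * c j * e (m - j)) * indicator (U \<inter> V) x)"
  by (intro ext) (auto simp: leibniz_def indicator_def sum_distrib_right)

text \<open>
  The functions \<open>p(1/x) exp(-1/x)\<close>, extended by zero to \<open>x \<le> 0\<close>, form a family closed under
  differentiation.  This makes the flat function \<open>exp(-1/x)\<close> (the case \<open>p = 1\<close>) smooth, with bounded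
  derivatives of every order.
\<close>

definition flat :: "real poly \<Rightarrow> real \<Rightarrow> real" where
  "flat p x = (if x > 0 then poly p (1 / x) * exp (- (1 / x)) else 0)"

definition flat_deriv :: "real poly \<Rightarrow> real poly" where
  "flat_deriv p = [:0, 0, 1:] * (p - pderiv p)"

definition flat_bound :: "real poly \<Rightarrow> real" where
  "flat_bound p = (\<Sum>i\<le>degree p. \<bar>coeff p i\<bar> * fact i)"

lemma power_le_fact_exp:
  assumes "0 \<le> (y::real)"
  shows "y ^ n \<le> fact n * exp y"
proof -
  have "(\<Sum>k\<in>{n}. y ^ k /\<^sub>R fact k) \<le> (\<Sum>k. y ^ k /\<^sub>R fact k)"
    by (rule sum_le_suminf) (use assms summable_exp_generic[of y] in auto)
  then show ?thesis by (simp add: exp_def field_simps)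
qed

text \<open>
  With \<open>y = 1/x\<close> this is \<open>y\<^sup>n exp(-y) \<le> n!\<close> for each monomial of \<open>p\<close>.
\<close>

lemma flat_le: "\<bar>flat p x\<bar> \<le> flat_bound p * indicator {0<..} x"
proof (cases "x > 0")
  case True
  define y where "y = 1 / x"
  have y: "0 \<le> y" using True by (simp add: y_def)
  have "\<bar>poly p y\<bar> \<le> (\<Sum>i\<le>degree p. \<bar>coeff p i * y ^ i\<bar>)"
    unfolding poly_altdef by (rule sum_abs)
  also have "\<dots> \<le> (\<Sum>i\<le>degree p. \<bar>coeff p i\<bar> * (fact i * exp y))"
    by (intro sum_mono) (use y in \<open>auto simp: abs_mult intro!: mult_left_mono power_le_fact_exp\<close>)
  also have "\<dots> = flat_bound p * exp y"
    by (simp add: flat_bound_def sum_distrib_right mult.assoc)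
  finally have "\<bar>poly p y\<bar> * exp (- y) \<le> flat_bound p * exp y * exp (- y)"
    by (rule mult_right_mono) simp
  also have "\<dots> = flat_bound p"
    by (simp add: mult.assoc flip: exp_add)
  finally show ?thesis using True
    by (simp add: flat_def y_def abs_mult)
qed (simp add: flat_def)

lemma flat_bound_nonneg: "0 \<le> flat_bound p"
  by (simp add: flat_bound_def sum_nonneg)

lemma flat_has_derivative:
  "(flat p has_real_derivative flat (flat_deriv p) x) (at x)"
proof -
  consider "x < 0" | "x = 0" | "x > 0" by linarith
  then show ?thesis
  proof cases
    case 1
    have "((\<lambda>_. 0) has_real_derivative 0) (at x)" by simp
    then have "(flat p has_real_derivative 0) (at x)"
      by (rule has_field_derivative_transform_within_open[of _ _ _ "{..<0}"])
         (use 1 in \<open>auto simp: flat_def\<close>)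
    with 1 show ?thesis by (simp add: flat_def)
  next
    case 2
    \<comment> \<open>As \<open>flat p h = h\<^sup>2 flat ?q h\<close> and \<open>flat ?q\<close> is bounded, the difference quotient is \<open>O(h)\<close>.\<close>
    let ?q = "[:0, 0, 1:] * p"
    have bd: "\<bar>flat p h / h\<bar> \<le> flat_bound ?q * \<bar>h\<bar>" for h
    proof (cases "h > 0")
      case True
      then have "flat p h / h = h * flat ?q h"
        by (simp add: flat_def field_simps)
      then show ?thesis
        using mult_left_mono[OF flat_le[of ?q h], of "\<bar>h\<bar>"] True by (simp add: abs_mult mult.commute)
    next
      case False
      then have "flat p h / h = 0" by (simp add: flat_def)
      moreover have "0 \<le> flat_bound ?q * \<bar>h\<bar>"
        by (intro mult_nonneg_nonneg flat_bound_nonneg) simp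
      ultimately show ?thesis by (simp only: abs_zero)
    qed
    have "((\<lambda>h. flat p h / h) \<longlongrightarrow> 0) (at 0)"
    proof (rule Lim_null_comparison)
      show "\<forall>\<^sub>F h in at 0. norm (flat p h / h) \<le> flat_bound ?q * \<bar>h\<bar>"
        using bd by (auto simp only: real_norm_def intro: always_eventually)
      have "((\<lambda>h. flat_bound ?q * \<bar>h\<bar>) \<longlongrightarrow> flat_bound ?q * \<bar>0\<bar>) (at 0)"
        by (intro tendsto_intros)
      then show "((\<lambda>h. flat_bound ?q * \<bar>h\<bar>) \<longlongrightarrow> 0) (at 0)" by simp
    qed
    then show ?thesis using 2 by (simp add: DERIV_def flat_def)
  next
    case 3
    have "((\<lambda>x. poly p (1 / x) * exp (- (1 / x))) has_real_derivative
        (poly (pderiv p) (1 / x) * (- (1 / x^2)) * exp (- (1 / x)) +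
         poly p (1 / x) * (exp (- (1 / x)) * (1 / x^2)))) (at x)"
      using 3 by (auto intro!: derivative_eq_intros DERIV_chain2[OF poly_DERIV] simp: power2_eq_square)
    also have "(poly (pderiv p) (1 / x) * (- (1 / x^2)) * exp (- (1 / x)) +
         poly p (1 / x) * (exp (- (1 / x)) * (1 / x^2))) = flat (flat_deriv p) x"
      using 3 by (simp add: flat_def flat_deriv_def field_simps power2_eq_square)
    finally show ?thesis
      by (rule has_field_derivative_transform_within_open[of _ _ _ "{0<..}"])
         (use 3 in \<open>auto simp: flat_def\<close>)
  qed
qed

lemma derivs_le_flat:
  "derivs_le N (\<lambda>m x. flat_bound ((flat_deriv ^^ m) p) * indicator {0<..} x) (flat p)"
proof (induction N arbitrary: p)
  case 0
  have "flat p differentiable (at x)" for x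
    using flat_has_derivative real_differentiable_def by blast
  then show ?case using flat_le[of p] by simp
next
  case (Suc N)
  show ?case
  proof (rule derivs_le_SucI[where f'="\<lambda>x h. flat (flat_deriv p) x * h"])
    show "(flat p has_derivative (\<lambda>h. flat (flat_deriv p) x * h)) (at x)" for x
      using flat_has_derivative[of p x] by (simp add: has_field_derivative_def)
    show "derivs_le N (\<lambda>m x. flat_bound ((flat_deriv ^^ Suc m) p) * indicator {0<..} x)
            (\<lambda>x. flat (flat_deriv p) x * b)" if "b \<in> Basis" for b
      using Suc.IH[of "flat_deriv p"] that by (simp add: funpow_swap1)
  qed (use flat_le in auto)
qed

lemma exists_smooth_bump:
  obtains b :: "real \<Rightarrow> real" and C :: "nat \<Rightarrow> real"
  where "\<And>N. derivs_le N (\<lambda>m x. C m * indicator {0<..<1} x) b"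
    and "\<And>x. 0 \<le> b x" and "0 < b (1/2)" and "\<And>m. 0 \<le> C m"
proof
  let ?K = "\<lambda>m. flat_bound ((flat_deriv ^^ m) 1)"
  let ?C = "\<lambda>m. \<Sum>j\<le>m. real (m choose j) * ?K j * ?K (m - j)"
  let ?b = "\<lambda>x. flat 1 x * flat 1 ((-1) *\<^sub>R x + 1)"
  show "derivs_le N (\<lambda>m x. ?C m * indicator {0<..<1} x) ?b" for N
  proof -
    have "derivs_le N (\<lambda>m x. ?K m * indicator {..<1} x) (\<lambda>x. flat 1 ((-1) *\<^sub>R x + 1))"
      using derivs_le_affine[OF derivs_le_flat[of N 1], of "-1" 1]
      by (rule derivs_le_mono) (auto simp: indicator_def)
    from derivs_le_mult[OF derivs_le_flat this] show ?thesis
      unfolding leibniz_indicator by (rule derivs_le_mono) (auto simp: indicator_def)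
  qed
  show "0 \<le> ?b x" for x by (simp add: flat_def)
  show "0 < ?b (1/2)" by (simp add: flat_def)
  show "0 \<le> ?C m" for m by (intro sum_nonneg mult_nonneg_nonneg flat_bound_nonneg) auto
qed

text \<open>
  The normalized antiderivative of a bump.  The bounds are stated for the derivative \<open>b\<close>, because that is
  the part with compact support.
\<close>

lemma exists_smooth_step:
  obtains h :: "real \<Rightarrow> real" and b :: "real \<Rightarrow> real" and C :: "nat \<Rightarrow> real"
  where "\<And>s. s \<le> 0 \<Longrightarrow> h s = 0" "\<And>s. s \<ge> 1 \<Longrightarrow> h s = 1" "mono h"
    "\<And>x. (h has_real_derivative b x) (at x)"
    "\<And>N. derivs_le N (\<lambda>m x. C m * indicator {0<..<1} x) b" "\<And>m. 0 \<le> C m"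
proof -
  obtain b C where b: "\<And>N. derivs_le N (\<lambda>m x. C m * indicator {0<..<1} x) b"
    "\<And>x. 0 \<le> b x" "0 < b (1/2::real)" and C: "\<And>m. 0 \<le> C m"
    by (rule exists_smooth_bump) (rule that)
  have cont: "isCont b x" for x
    using derivs_le_differentiable[OF b(1)] differentiable_imp_continuous_within by blast
  obtain H where H: "\<And>x. (H has_vector_derivative b x) (at x)"
    using einterval_antiderivative[of "-\<infinity>" "\<infinity>" b] cont by auto
  then have H: "\<And>x. (H has_real_derivative b x) (at x)"
    by (simp add: has_real_derivative_iff_has_vector_derivative)
  have b0: "b x = 0" if "x \<le> 0 \<or> x \<ge> 1" for x
    using derivs_le_bound[OF b(1)[of 0], of x] that by auto
  have mono: "mono H"
    by (rule monoI, rule DERIV_nonneg_imp_nondecreasing) (use H b(2) in auto)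
  have const: "H x = H y" if "x < y" "y \<le> 0 \<or> 1 \<le> x" for x y
  proof -
    obtain z where "x < z" "z < y" "H y - H x = (y - x) * b z"
      using MVT2[of x y H b] \<open>x < y\<close> H by blast
    then show ?thesis using b0[of z] that by auto
  qed
  have H0: "H s = H 0" if "s \<le> 0" for s
    using const[of s 0] that by (cases "s = 0") auto
  have H1: "H s = H 1" if "s \<ge> 1" for s
    using const[of 1 s] that by (cases "s = 1") auto
  have lt: "H 0 < H 1"
  proof -
    obtain d where d: "d > 0" "\<And>e. 0 < e \<Longrightarrow> e < d \<Longrightarrow> H (1/2) < H (1/2 + e)"
      using DERIV_pos_inc_right[OF H b(3)] by blast
    define e where "e = min (d/2) (1/2)"
    have "H 0 \<le> H (1/2)" "H (1/2 + e) \<le> H 1"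
      using d(1) by (auto intro!: monoD[OF mono] simp: e_def)
    moreover have "H (1/2) < H (1/2 + e)"
      using d by (intro d(2)) (auto simp: e_def)
    ultimately show ?thesis by linarith
  qed
  define c where "c = H 1 - H 0"
  have c: "0 < c" using lt by (simp add: c_def)
  show thesis
  proof
    let ?h = "\<lambda>s. (H s - H 0) / c"
    show "?h s = 0" if "s \<le> 0" for s using H0[OF that] by simp
    show "?h s = 1" if "s \<ge> 1" for s using H1[OF that] c by (simp add: c_def)
    show "mono ?h"
      using mono c by (auto simp: mono_def divide_right_mono)
    show "(?h has_real_derivative inverse c * b x) (at x)" for x
      using c by (auto intro!: derivative_eq_intros H simp: field_simps)
    show "derivs_le N (\<lambda>m x. (inverse c * C m) * indicator {0<..<1} x) (\<lambda>x. inverse c * b x)" for N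
      using derivs_le_cmult[OF b(1), where c="inverse c"] c by (simp add: mult.assoc)
    show "0 \<le> inverse c * C m" for m using c C by simp
  qed
qed

text \<open>
  Put \<open>\<theta>(s) = h(s + 1) - h(s)\<close> for a smooth step \<open>h\<close> from 0 to 1: the integer translates telescope.
\<close>

lemma exists_partition_bump:
  obtains \<theta> :: "real \<Rightarrow> real" and C :: "nat \<Rightarrow> real"
  where "\<And>N. derivs_le N (\<lambda>m x. C m * indicator {-1<..<1} x) \<theta>" "\<And>m. 0 \<le> C m"
    "\<And>s. 0 \<le> \<theta> s"
    "\<And>y a b. of_int a \<le> y \<Longrightarrow> y \<le> of_int b \<Longrightarrow> (\<Sum>m\<in>{a..b}. \<theta> (y - of_int m)) = 1"
proof -
  obtain h b C where h: "\<And>s::real. s \<le> 0 \<Longrightarrow> h s = 0" "\<And>s. s \<ge> 1 \<Longrightarrow> h s = (1::real)" "mono h"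
    "\<And>x. (h has_real_derivative b x) (at x)"
    and b: "\<And>N. derivs_le N (\<lambda>m x. C m * indicator {0<..<1} x) b" and C: "\<And>m. 0 \<le> C m"
    by (rule exists_smooth_step) (rule that)
  have h01: "0 \<le> h s" "h s \<le> 1" for s
  proof -
    show "0 \<le> h s" using h(1) monoD[OF h(3), of 0 s] by (cases "s \<le> 0") auto
    show "h s \<le> 1" using h(2) monoD[OF h(3), of s 1] by (cases "s \<ge> 1") auto
  qed
  define \<theta> where "\<theta> = (\<lambda>s. h (s + 1) - h s)"
  \<comment> \<open>The derivative of \<open>\<theta>\<close> of order \<open>n + 1\<close> is the derivative of order \<open>n\<close> of a difference of two bumps with
    disjoint supports, hence the shift of the constants by one.\<close>
  define D where "D = (\<lambda>m. case m of 0 \<Rightarrow> 1 | Suc n \<Rightarrow> C n)"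
  show thesis
  proof
    have le: "\<bar>\<theta> s\<bar> \<le> D 0 * indicator {-1<..<1} s" for s
      using h(1)[of s] h(1)[of "s+1"] h(2)[of s] h(2)[of "s+1"] h01[of s] h01[of "s+1"]
      by (auto simp: \<theta>_def D_def indicator_def)
    have deriv: "(\<theta> has_real_derivative b (s + 1) - b s) (at s)" for s
      unfolding \<theta>_def by (auto intro!: derivative_eq_intros DERIV_chain2[OF h(4)] h(4))
    have db: "derivs_le N (\<lambda>m x. C m * indicator {-1<..<1} x) (\<lambda>s. b (s + 1) - b s)" for N
    proof -
      have "derivs_le N (\<lambda>m x. \<bar>1\<bar> ^ m * (C m * indicator {0<..<1} (1 *\<^sub>R x + 1)) + C m * indicator {0<..<1} x)
          (\<lambda>s. b (1 *\<^sub>R s + 1) + - b s)"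
        by (intro derivs_le_add derivs_le_affine derivs_le_minus b)
      then have "derivs_le N (\<lambda>m x. C m * indicator {0<..<1} (x + 1) + C m * indicator {0<..<1} x)
          (\<lambda>s. b (s + 1) - b s)"
        by simp
      then show ?thesis
        by (rule derivs_le_mono) (use C in \<open>auto simp: indicator_def\<close>)
    qed
    show "derivs_le N (\<lambda>m x. D m * indicator {-1<..<1} x) \<theta>" for N
    proof (cases N)
      case 0
      then show ?thesis using deriv le by (auto simp: real_differentiable_def)
    next
      case (Suc n)
      show ?thesis unfolding Suc
        by (rule derivs_le_SucI[where f'="\<lambda>x k. (b (x + 1) - b x) * k"])
           (use deriv le db[of n] in \<open>auto simp: has_field_derivative_def D_def\<close>)
    qed
    show "0 \<le> \<theta> s" for s using monoD[OF h(3), of s "s + 1"] by (simp add: \<theta>_def)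
    show "0 \<le> D m" for m using C by (auto simp: D_def split: nat.split)
    show "(\<Sum>m\<in>{a..c}. \<theta> (y - of_int m)) = 1" if "of_int a \<le> y" "y \<le> of_int c" for y a c
    proof -
      have "(\<Sum>m\<in>{a..c}. \<theta> (y - of_int m)) = h (y - of_int a + 1) - h (y - of_int c)" if "a \<le> c"
        using that
      proof (induction c rule: int_ge_induct)
        case base
        then show ?case by (simp add: \<theta>_def)
      next
        case (step i)
        have "{a..i + 1} = insert (i + 1) {a..i}" using step.hyps by auto
        then show ?case using step.IH by (simp add: \<theta>_def algebra_simps)
      qed
      moreover have "a \<le> c" using that by linarith
      ultimately show ?thesis using that h(1)[of "y - of_int c"] h(2)[of "y - of_int a + 1"] by simp
    qed
  qed
qed

section \<open>Lattice partitions and products over dyadic scales\<close>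

definition sup_unit_ball :: "'a::euclidean_space set" where
  "sup_unit_ball = {x. \<forall>i\<in>Basis. \<bar>x \<bullet> i\<bar> < 1}"

definition lattice :: "('a::euclidean_space \<Rightarrow> int) \<Rightarrow> 'a" where
  "lattice n = (\<Sum>i\<in>Basis. of_int (n i) *\<^sub>R i)"

lemma inner_lattice [simp]: "i \<in> Basis \<Longrightarrow> lattice n \<bullet> i = of_int (n i)"
  by (simp add: lattice_def inner_sum_left inner_Basis if_distrib cong: if_cong)

lemma derivs_le_prod:
  assumes "finite I" "\<And>i N. i \<in> I \<Longrightarrow> derivs_le N (\<lambda>m x. c m * indicator (U i) x) (f i)"
  shows "\<exists>B. \<forall>N. derivs_le N (\<lambda>m x. B m * indicator (\<Inter>i\<in>I. U i) x) (\<lambda>x. \<Prod>i\<in>I. f i x)"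
  using assms
proof (induction I rule: finite_induct)
  case empty
  show ?case
    by (rule exI[of _ "\<lambda>m. if m = 0 then 1 else 0"])
       (auto intro: derivs_le_mono[OF derivs_le_const[of _ 1]])
next
  case (insert i I)
  then obtain B where B: "\<And>N. derivs_le N (\<lambda>m x. B m * indicator (\<Inter>i\<in>I. U i) x) (\<lambda>x. \<Prod>i\<in>I. f i x)"
    by (meson insertCI)
  have "derivs_le N (\<lambda>m x. c m * indicator (U i) x) (f i)" for N
    using insert.prems by blast
  from derivs_le_mult[OF this B] insert.hyps show ?case
    unfolding leibniz_indicator
    by (intro exI[of _ "\<lambda>m. \<Sum>j\<le>m. real (m choose j) * c j * B (m - j)"]) simp
qed

text \<open>
  Leibniz bounds lose a constant even at order zero.  For products of an unbounded number of factors
  \<open>1 - layer\<close> with values in \<open>[0, 1]\<close>, the sharp constant 1 at order zero is essential.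
\<close>

lemma derivs_le_zeroth:
  assumes "derivs_le N C f" "\<And>x. \<bar>f x\<bar> \<le> c"
  shows "derivs_le N (\<lambda>m x. if m = 0 then c else C m x) f"
  using assms by (cases N) auto

text \<open>
  For \<open>m \<ge> 1\<close>, \<open>growth D m\<close> is exactly the sum of those terms in the Leibniz bound for the pair \<open>growth D\<close>,
  \<open>D\<close> of order \<open>m\<close> in which \<open>growth D\<close> occurs with an order below \<open>m\<close>.
\<close>

fun growth :: "(nat \<Rightarrow> real) \<Rightarrow> nat \<Rightarrow> real" where
  "growth D 0 = 1"
| "growth D (Suc m) = (\<Sum>j\<le>m. real (Suc m choose j) * growth D j * D (Suc m - j))"

lemma growth_nonneg:
  assumes "\<And>m. 0 \<le> D m"
  shows "0 \<le> growth D m"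
proof (induction m rule: less_induct)
  case (less m)
  then show ?case
    by (cases m) (auto intro!: sum_nonneg mult_nonneg_nonneg assms simp: less_Suc_eq_le)
qed

text \<open>
  Multiplication by one further factor of scale \<open>2\<^sup>-\<^sup>k\<close> turns bounds of scale \<open>2\<^sup>-\<^sup>k\<close> into bounds of scale
  \<open>2\<^sup>-\<^sup>(\<^sup>k\<^sup>+\<^sup>1\<^sup>)\<close> with the \<^emph>\<open>same\<close> constants, so that arbitrarily many scales can be multiplied.  At order
  \<open>m \<ge> 1\<close> the Leibniz terms add up to twice \<open>growth D m\<close>, and the passage to the next scale provides the
  factor \<open>2\<^sup>m \<ge> 2\<close>; at order 0 nothing is lost since \<open>D 0 = 1\<close>.
\<close>

lemma derivs_le_mult_growth:
  assumes D: "\<And>m. 0 \<le> D m" "D 0 = 1"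
    and f: "derivs_le N (\<lambda>m x. growth D m * (2 ^ k) ^ m) f"
    and g: "derivs_le N (\<lambda>m x. D m * (2 ^ k) ^ m) g"
  shows "derivs_le N (\<lambda>m x. growth D m * (2 ^ Suc k) ^ m) (\<lambda>x. f x * g x)"
proof (rule derivs_le_mono[OF derivs_le_mult[OF f g]])
  fix m :: nat and x :: 'a
  have "leibniz (\<lambda>m x. growth D m * (2 ^ k) ^ m) (\<lambda>m x. D m * (2 ^ k) ^ m) m x =
      (\<Sum>j\<le>m. real (m choose j) * growth D j * D (m - j)) * (2 ^ k) ^ m"
    unfolding leibniz_def sum_distrib_right
    by (rule sum.cong) (auto simp: power_add[symmetric] mult_ac)
  also have "\<dots> \<le> (growth D m * 2 ^ m) * (2 ^ k) ^ m"
  proof (intro mult_right_mono)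
    show "(\<Sum>j\<le>m. real (m choose j) * growth D j * D (m - j)) \<le> growth D m * 2 ^ m"
    proof (cases m)
      case 0
      then show ?thesis by (simp add: D)
    next
      case (Suc l)
      have "(\<Sum>j\<le>m. real (m choose j) * growth D j * D (m - j)) = 2 * growth D m"
        unfolding Suc by (subst sum.atMost_Suc) (simp add: D)
      also have "\<dots> \<le> 2 ^ m * growth D m"
        using growth_nonneg[of D, OF D(1), of m] self_le_power[of "2::real" m] Suc
        by (intro mult_right_mono) auto
      finally show ?thesis by (simp add: mult.commute)
    qed
  qed simp
  also have "\<dots> = growth D m * (2 ^ Suc k) ^ m"
    by (simp add: power_mult_distrib)
  finally show "leibniz (\<lambda>m x. growth D m * (2 ^ k) ^ m) (\<lambda>m x. D m * (2 ^ k) ^ m) m x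
      \<le> growth D m * (2 ^ Suc k) ^ m" .
qed

text \<open>
  A bump whose integer translates form a partition of unity.  Lattice points are indexed by extensional
  functions on the basis, so that boxes of lattice points are sets of the form \<open>\<Pi>\<^sub>E\<close>.  Summing over any box
  that contains all lattice points near \<open>y\<close> already gives 1; no infinite sums occur.
\<close>

locale lattice_partition =
  fixes \<phi> :: "'a::euclidean_space \<Rightarrow> real" and B :: "nat \<Rightarrow> real"
  assumes derivs: "\<And>N. derivs_le N (\<lambda>m x. B m * indicator sup_unit_ball x) \<phi>"
    and bound_nonneg: "\<And>m. 0 \<le> B m"
    and nonneg: "\<And>x. 0 \<le> \<phi> x"
    and partition: "\<And>y a b. (\<And>i. i \<in> Basis \<Longrightarrow> of_int (a i) \<le> y \<bullet> i \<and> y \<bullet> i \<le> of_int (b i)) \<Longrightarrow>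
      (\<Sum>n\<in>(\<Pi>\<^sub>E i\<in>Basis. {a i..b i}). \<phi> (y - lattice n)) = 1"

lemma exists_lattice_partition:
  obtains \<phi> :: "'a::euclidean_space \<Rightarrow> real" and B where "lattice_partition \<phi> B"
proof -
  obtain \<theta> C where \<theta>: "\<And>N. derivs_le N (\<lambda>m x. C m * indicator {-1<..<1::real} x) \<theta>"
    and C: "\<And>m. 0 \<le> C m" and nn: "\<And>s. 0 \<le> \<theta> s"
    and one: "\<And>y a b. of_int a \<le> y \<Longrightarrow> y \<le> of_int b \<Longrightarrow> (\<Sum>m\<in>{a..b}. \<theta> (y - of_int m)) = 1"
    by (rule exists_partition_bump) (rule that)
  have "derivs_le N (\<lambda>m (x::'a). C m * indicator {x. \<bar>x \<bullet> i\<bar> < 1} x) (\<lambda>x. \<theta> (x \<bullet> i))"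
    if "i \<in> Basis" for i N
    using derivs_le_coordinate[OF \<theta> that, of N]
    by (rule derivs_le_mono) (use C in \<open>auto simp: indicator_def abs_less_iff\<close>)
  from derivs_le_prod[OF finite_Basis, where c=C and U="\<lambda>i. {x. \<bar>x \<bullet> i\<bar> < 1}"
      and f="\<lambda>i x. \<theta> (x \<bullet> i)", OF this] obtain B
    where B: "\<And>N. derivs_le N (\<lambda>m (x::'a). B m * indicator (\<Inter>i\<in>Basis. {x. \<bar>x \<bullet> i\<bar> < 1}) x)
        (\<lambda>x. \<Prod>i\<in>Basis. \<theta> (x \<bullet> i))" by blast
  have U: "(\<Inter>i\<in>Basis. {x::'a. \<bar>x \<bullet> i\<bar> < 1}) = sup_unit_ball"
    by (auto simp: sup_unit_ball_def)
  have "lattice_partition (\<lambda>x::'a. \<Prod>i\<in>Basis. \<theta> (x \<bullet> i)) (\<lambda>m. \<bar>B m\<bar>)"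
  proof
    show "derivs_le N (\<lambda>m x. \<bar>B m\<bar> * indicator sup_unit_ball x) (\<lambda>x::'a. \<Prod>i\<in>Basis. \<theta> (x \<bullet> i))" for N
      using B[unfolded U] by (rule derivs_le_mono) (auto simp: indicator_def)
    show "0 \<le> (\<Prod>i\<in>Basis. \<theta> (x \<bullet> i))" for x :: 'a by (simp add: nn prod_nonneg)
    show "(\<Sum>n\<in>(\<Pi>\<^sub>E i\<in>Basis. {a i..b i}). \<Prod>i\<in>Basis. \<theta> ((y - lattice n) \<bullet> i)) = 1"
      if "\<And>i. i \<in> Basis \<Longrightarrow> of_int (a i) \<le> y \<bullet> i \<and> y \<bullet> i \<le> of_int (b i)" for y :: 'a and a b
    proof -
      have "(\<Sum>n\<in>(\<Pi>\<^sub>E i\<in>Basis. {a i..b i}). \<Prod>i\<in>Basis. \<theta> ((y - lattice n) \<bullet> i)) =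
          (\<Sum>n\<in>(\<Pi>\<^sub>E i\<in>Basis. {a i..b i}). \<Prod>i\<in>Basis. \<theta> (y \<bullet> i - of_int (n i)))"
        by (intro sum.cong prod.cong) (auto simp: inner_diff_left)
      also have "\<dots> = (\<Prod>i\<in>Basis. \<Sum>m\<in>{a i..b i}. \<theta> (y \<bullet> i - of_int m))"
        by (rule prod_sum_PiE[symmetric]) auto
      also have "\<dots> = 1" by (rule prod.neutral) (use one that in auto)
      finally show ?thesis .
    qed
  qed simp
  then show thesis by (rule that)
qed

context lattice_partition begin

definition atom :: "nat \<Rightarrow> ('a \<Rightarrow> int) \<Rightarrow> 'a \<Rightarrow> real" where
  "atom k n x = \<phi> (2 ^ k *\<^sub>R x - lattice n)"

definition layer :: "('a \<Rightarrow> int) set \<Rightarrow> nat \<Rightarrow> 'a \<Rightarrow> real" where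
  "layer S k x = (\<Sum>n\<in>S. atom k n x)"

text \<open>
  What the scales coarser than \<open>k\<close> have left over: \<open>S j\<close> indexes the bumps chosen at scale \<open>2\<^sup>-\<^sup>j\<close>.
\<close>

definition remainder :: "(nat \<Rightarrow> ('a \<Rightarrow> int) set) \<Rightarrow> nat \<Rightarrow> 'a \<Rightarrow> real" where
  "remainder S k x = (\<Prod>j<k. 1 - layer (S j) j x)"

abbreviation "indices \<equiv> (\<Pi>\<^sub>E i\<in>(Basis::'a set). (UNIV::int set))"

lemma atom_nonneg: "0 \<le> atom k n x"
  by (simp add: atom_def nonneg)

lemma derivs_le_atom:
  "derivs_le N (\<lambda>m x. B m * (2 ^ k) ^ m * indicator sup_unit_ball (2 ^ k *\<^sub>R x - lattice n)) (atom k n)"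
  using derivs_le_affine[OF derivs, of N "2 ^ k" "- lattice n"]
  unfolding atom_def[abs_def] by (simp add: mult_ac)

lemma atom_eq_0: "2 ^ k *\<^sub>R x - lattice n \<notin> sup_unit_ball \<Longrightarrow> atom k n x = 0"
  using derivs_le_bound[OF derivs_le_atom[of 0], of k n x] by simp

text \<open>
  Enlarge \<open>S\<close> to a box that surrounds \<open>y\<close>, on which the translates sum to 1.
\<close>

lemma layer_le_1:
  assumes S: "finite S" "S \<subseteq> indices"
  shows "layer S k y \<le> 1"
proof -
  define M where "M = (\<lambda>i. \<lceil>\<bar>2 ^ k * (y \<bullet> i)\<bar>\<rceil> + (\<Sum>n\<in>S. \<bar>n i\<bar>))"
  have "S \<subseteq> (\<Pi>\<^sub>E i\<in>Basis. {- M i..M i})"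
  proof
    fix n assume n: "n \<in> S"
    have "\<bar>n i\<bar> \<le> M i" if "i \<in> Basis" for i
    proof -
      have "\<bar>n i\<bar> \<le> (\<Sum>n\<in>S. \<bar>n i\<bar>)" using S(1) n by (intro member_le_sum) auto
      moreover have "0 \<le> \<lceil>\<bar>2 ^ k * (y \<bullet> i)\<bar>\<rceil>" by linarith
      ultimately show ?thesis unfolding M_def by linarith
    qed
    then show "n \<in> (\<Pi>\<^sub>E i\<in>Basis. {- M i..M i})"
      using n S(2) by (force simp: PiE_def Pi_def abs_le_iff)
  qed
  then have "layer S k y \<le> (\<Sum>n\<in>(\<Pi>\<^sub>E i\<in>Basis. {- M i..M i}). atom k n y)"
    unfolding layer_def by (intro sum_mono2 atom_nonneg finite_PiE) auto
  also have "\<dots> = 1"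
    unfolding atom_def
  proof (rule partition)
    fix i :: 'a
    have "\<bar>2 ^ k * (y \<bullet> i)\<bar> \<le> of_int \<lceil>\<bar>2 ^ k * (y \<bullet> i)\<bar>\<rceil>" by (rule le_of_int_ceiling)
    also have "\<dots> \<le> of_int (M i)" unfolding M_def of_int_le_iff by (simp add: sum_nonneg)
    finally show "of_int (- M i) \<le> 2 ^ k *\<^sub>R y \<bullet> i \<and> 2 ^ k *\<^sub>R y \<bullet> i \<le> of_int (M i)"
      by (simp add: abs_le_iff)
  qed
  finally show ?thesis .
qed

lemma layer_nonneg: "0 \<le> layer S k y"
  by (simp add: layer_def atom_nonneg sum_nonneg)

lemma layer_ge_1:
  assumes S: "finite S" "(\<Pi>\<^sub>E i\<in>Basis. {n i - 1..n i + 2}) \<subseteq> S"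
    and y: "\<And>i. i \<in> Basis \<Longrightarrow> of_int (n i) - 1 \<le> 2 ^ k * (y \<bullet> i) \<and> 2 ^ k * (y \<bullet> i) \<le> of_int (n i) + 2"
  shows "1 \<le> layer S k y"
proof -
  have "1 = (\<Sum>n\<in>(\<Pi>\<^sub>E i\<in>Basis. {n i - 1..n i + 2}). atom k n y)"
    unfolding atom_def by (rule partition[symmetric]) (use y in auto)
  also have "\<dots> \<le> layer S k y"
    unfolding layer_def using S by (intro sum_mono2 atom_nonneg) auto
  finally show ?thesis .
qed

text \<open>
  At most \<open>4\<^sup>d\<close> bumps of one scale overlap, which makes the derivative bounds of a layer independent of
  the number of its bumps.
\<close>

lemma card_overlap:
  assumes "finite S" "S \<subseteq> indices"
  shows "card {n\<in>S. 2 ^ k *\<^sub>R x - lattice n \<in> sup_unit_ball} \<le> 4 ^ DIM('a)"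
proof -
  let ?f = "\<lambda>i. \<lfloor>2 ^ k * (x \<bullet> i)\<rfloor>"
  have "{n\<in>S. 2 ^ k *\<^sub>R x - lattice n \<in> sup_unit_ball} \<subseteq> (\<Pi>\<^sub>E i\<in>Basis. {?f i - 1..?f i + 2})"
  proof
    fix n assume "n \<in> {n\<in>S. 2 ^ k *\<^sub>R x - lattice n \<in> sup_unit_ball}"
    then have n: "n \<in> indices" and *: "\<And>i. i \<in> Basis \<Longrightarrow> \<bar>2 ^ k * (x \<bullet> i) - of_int (n i)\<bar> < 1"
      using assms(2) by (auto simp: sup_unit_ball_def inner_diff_left)
    have "?f i - 1 \<le> n i \<and> n i \<le> ?f i + 2" if "i \<in> Basis" for i
      using *[OF that] by linarith
    with n show "n \<in> (\<Pi>\<^sub>E i\<in>Basis. {?f i - 1..?f i + 2})"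
      by (auto simp: PiE_def Pi_def)
  qed
  then have "card {n\<in>S. 2 ^ k *\<^sub>R x - lattice n \<in> sup_unit_ball} \<le> card (\<Pi>\<^sub>E i\<in>Basis. {?f i - 1..?f i + 2})"
    by (intro card_mono finite_PiE) auto
  also have "\<dots> = 4 ^ DIM('a)" by (simp add: card_PiE)
  finally show ?thesis .
qed

definition layer_bound :: "nat \<Rightarrow> real" where
  "layer_bound m = (if m = 0 then 1 else 4 ^ DIM('a) * B m)"

lemma layer_bound_nonneg: "0 \<le> layer_bound m"
  by (simp add: layer_bound_def bound_nonneg)

lemma derivs_le_one_minus_layer:
  assumes "finite S" "S \<subseteq> indices"
  shows "derivs_le N (\<lambda>m x. layer_bound m * (2 ^ k) ^ m) (\<lambda>x. 1 - layer S k x)"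
proof -
  let ?L = "\<lambda>m x. \<Sum>n\<in>S. B m * (2 ^ k) ^ m * indicator sup_unit_ball (2 ^ k *\<^sub>R x - lattice n)"
  have L: "?L m x \<le> 4 ^ DIM('a) * B m * (2 ^ k) ^ m" for m x
  proof -
    have "?L m x = B m * (2 ^ k) ^ m * real (card {n\<in>S. 2 ^ k *\<^sub>R x - lattice n \<in> sup_unit_ball})"
      using assms(1) by (simp add: indicator_def sum.If_cases Int_def flip: sum_distrib_left)
    also have "\<dots> \<le> B m * (2 ^ k) ^ m * 4 ^ DIM('a)"
      using of_nat_mono[OF card_overlap[OF assms, of k x], where 'a=real] bound_nonneg[of m]
      by (intro mult_left_mono) simp_all
    finally show ?thesis by (simp add: mult_ac)
  qed
  have "derivs_le N (\<lambda>m x. (if m = 0 then \<bar>1\<bar> else 0) + ?L m x) (\<lambda>x. 1 + - layer S k x)"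
    unfolding layer_def[abs_def]
    by (intro derivs_le_add derivs_le_const derivs_le_minus derivs_le_sum assms(1) derivs_le_atom)
  then have "derivs_le N (\<lambda>m x. (if m = 0 then \<bar>1\<bar> else 0) + ?L m x) (\<lambda>x. 1 - layer S k x)"
    by simp
  moreover have "\<bar>1 - layer S k x\<bar> \<le> 1" for x
    using layer_nonneg[of S k x] layer_le_1[OF assms, of k x] by linarith
  ultimately have "derivs_le N (\<lambda>m x. if m = 0 then 1 else (if m = 0 then \<bar>1\<bar> else 0) + ?L m x)
      (\<lambda>x. 1 - layer S k x)"
    by (rule derivs_le_zeroth)
  then show ?thesis
    by (rule derivs_le_mono) (use L in \<open>auto simp: layer_bound_def\<close>)
qed

lemma derivs_le_remainder:
  assumes S: "\<And>j. finite (S j)" "\<And>j. S j \<subseteq> indices"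
  shows "derivs_le N (\<lambda>m x. growth layer_bound m * (2 ^ k) ^ m) (remainder S k)"
proof (induction k)
  case 0
  have "derivs_le N (\<lambda>m x. if m = 0 then \<bar>1\<bar> else 0) (remainder S 0)"
    using derivs_le_const[of N 1] unfolding remainder_def[abs_def] by simp
  then show ?case
    by (rule derivs_le_mono) (auto simp: growth_nonneg layer_bound_nonneg)
next
  case (Suc k)
  have "remainder S (Suc k) = (\<lambda>x. remainder S k x * (1 - layer (S k) k x))"
    by (simp add: remainder_def fun_eq_iff)
  then show ?case
    using derivs_le_mult_growth[OF layer_bound_nonneg _ Suc derivs_le_one_minus_layer[OF S]]
    by (simp add: layer_bound_def)
qed

lemma remainder_bounds:
  assumes S: "\<And>j. finite (S j)" "\<And>j. S j \<subseteq> indices"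
  shows "0 \<le> remainder S k x" "remainder S k x \<le> 1"
proof -
  show "0 \<le> remainder S k x"
    unfolding remainder_def using layer_le_1[OF S] by (intro prod_nonneg) auto
  show "remainder S k x \<le> 1"
    unfolding remainder_def using layer_le_1[OF S] layer_nonneg by (intro prod_le_1) auto
qed

text \<open>
  Telescoping decomposes \<open>1 - remainder\<close>, the cutoff used below, into pieces with one bump each.
\<close>

lemma one_minus_remainder:
  "1 - remainder S K x = (\<Sum>k<K. \<Sum>n\<in>S k. atom k n x * remainder S k x)"
proof (induction K)
  case 0
  then show ?case by (simp add: remainder_def)
next
  case (Suc K)
  have "1 - remainder S (Suc K) x = (1 - remainder S K x) + layer (S K) K x * remainder S K x"
    by (simp add: remainder_def algebra_simps)
  with Suc show ?case by (simp add: layer_def sum_distrib_right)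
qed

text \<open>
  The Leibniz bound of a piece, with the scale factored out.
\<close>

definition piece_bound :: "nat \<Rightarrow> real" where
  "piece_bound m = (\<Sum>j\<le>m. real (m choose j) * B j * growth layer_bound (m - j))"

lemma piece_bound_nonneg: "0 \<le> piece_bound m"
  unfolding piece_bound_def
  by (intro sum_nonneg mult_nonneg_nonneg bound_nonneg growth_nonneg layer_bound_nonneg) auto

text \<open>
  Although a piece carries a product over all coarser scales, it satisfies the bounds of a single bump of
  scale \<open>2\<^sup>-\<^sup>k\<close>, with constants that depend neither on \<open>k\<close> nor on \<open>S\<close>.
\<close>

lemma derivs_le_piece:
  assumes S: "\<And>j. finite (S j)" "\<And>j. S j \<subseteq> indices"
  shows "derivs_le N (\<lambda>m x. piece_bound m * (2 ^ k) ^ m * indicator sup_unit_ball (2 ^ k *\<^sub>R x - lattice n))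
    (\<lambda>x. atom k n x * remainder S k x)"
proof (rule derivs_le_mono[OF derivs_le_mult[OF derivs_le_atom derivs_le_remainder[OF S]]])
  fix m :: nat and x :: 'a
  let ?u = "indicator sup_unit_ball (2 ^ k *\<^sub>R x - lattice n) :: real"
  have "leibniz (\<lambda>m x. B m * (2 ^ k) ^ m * indicator sup_unit_ball (2 ^ k *\<^sub>R x - lattice n))
     (\<lambda>m x. growth layer_bound m * (2 ^ k) ^ m) m x
     = (\<Sum>j\<le>m. real (m choose j) * B j * growth layer_bound (m - j) * (2 ^ k) ^ m * ?u)"
    unfolding leibniz_def
    by (rule sum.cong) (auto simp: power_add[symmetric] mult_ac)
  then show "leibniz (\<lambda>m x. B m * (2 ^ k) ^ m * indicator sup_unit_ball (2 ^ k *\<^sub>R x - lattice n))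
     (\<lambda>m x. growth layer_bound m * (2 ^ k) ^ m) m x
     \<le> piece_bound m * (2 ^ k) ^ m * ?u"
    by (simp add: piece_bound_def sum_distrib_right)
qed

end

section \<open>Localized functions against the grand maximal function\<close>

lemma signed_integral_mult_left: "signed_integral \<mu> (\<lambda>y. c * f y) = c * signed_integral \<mu> f"
  by (simp add: signed_integral_def right_diff_distrib)

lemma schwartz_of_compact_derivs_le:
  assumes v: "\<And>N. derivs_le N (\<lambda>m z. E m * indicator (cball 0 R) z) v" and R: "0 \<le> R"
    and E: "\<And>m. 0 \<le> E m"
  shows "schwartz_seminorm p q (\<lambda>z. complex_of_real (v z)) \<le> ennreal ((1 + R) ^ p * (\<Sum>m\<le>q. E m))"
    and "schwartz (\<lambda>z. complex_of_real (v z))"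
proof -
  let ?\<Phi> = "\<lambda>z. complex_of_real (v z)"
  show le: "schwartz_seminorm p q ?\<Phi> \<le> ennreal ((1 + R) ^ p * (\<Sum>m\<le>q. E m))" for p q
    unfolding schwartz_seminorm_def
  proof (rule SUP_least, clarify)
    fix x :: 'a and bs :: "'a list" assume bs: "set bs \<subseteq> Basis" "length bs \<le> q"
    have "norm (iterated_partial bs ?\<Phi> x) = \<bar>iterated_partial bs v x\<bar>"
      by (simp add: iterated_partial_of_real[OF v bs(1)])
    also have "\<dots> \<le> E (length bs) * indicator (cball 0 R) x"
      by (rule derivs_le_iterated_partial(2)[OF v bs(1) order_refl])
    finally have "(1 + norm x) ^ p * norm (iterated_partial bs ?\<Phi> x)
        \<le> (1 + norm x) ^ p * (E (length bs) * indicator (cball 0 R) x)"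
      by (rule mult_left_mono) simp
    also have "\<dots> \<le> (1 + R) ^ p * E (length bs)"
      using R E by (auto simp: indicator_def intro!: mult_right_mono power_mono)
    also have "\<dots> \<le> (1 + R) ^ p * (\<Sum>m\<le>q. E m)"
      using bs R E by (intro mult_left_mono member_le_sum) auto
    finally show "ennreal ((1 + norm x) ^ p * norm (iterated_partial bs ?\<Phi> x))
        \<le> ennreal ((1 + R) ^ p * (\<Sum>m\<le>q. E m))"
      by (rule ennreal_leI)
  qed
  have "iterated_partial bs ?\<Phi> differentiable (at x)" if "set bs \<subseteq> Basis" for bs x
    unfolding iterated_partial_of_real[OF v that]
    using derivs_le_iterated_partial(1)[OF v that order_refl, of x]
    unfolding differentiable_def by (blast intro: has_derivative_of_real)
  moreover have "schwartz_seminorm p q ?\<Phi> < \<infinity>" for p q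
    using le_less_trans[OF le ennreal_less_top] by simp
  ultimately show "schwartz ?\<Phi>"
    by (simp add: schwartz_def smooth_def)
qed

text \<open>
  Dominates the Schwartz seminorms in \<open>F\<close> of every function supported in the ball of radius \<open>R\<close> about the
  origin with derivative bounds \<open>E\<close>; the summand 1 makes division by it harmless.
\<close>

definition seminorm_bound :: "(nat \<times> nat) set \<Rightarrow> (nat \<Rightarrow> real) \<Rightarrow> real \<Rightarrow> real" where
  "seminorm_bound F E R = 1 + (\<Sum>(p, q)\<in>F. (1 + R) ^ p * (\<Sum>m\<le>q. E m))"

lemma seminorm_bound_ge_1:
  assumes "\<And>m. 0 \<le> E m" "0 \<le> R"
  shows "1 \<le> seminorm_bound F E R"
  unfolding seminorm_bound_def using assms by (auto intro!: sum_nonneg mult_nonneg_nonneg)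

text \<open>
  Reflect \<open>u\<close> about \<open>x0\<close> and rescale it to unit size.  After division by \<open>seminorm_bound F E R\<close> the result
  \<open>\<Phi>\<close> competes in the supremum, and convolution with its dilation at \<open>x0\<close> is \<open>t\<^sup>-\<^sup>d \<integral>u d\<mu>\<close> up to that
  constant.
\<close>

lemma grand_maximal_controls_localized:
  fixes \<mu> :: "'a::euclidean_space set \<Rightarrow> real"
  assumes F: "finite F" and E: "\<And>m. 0 \<le> E m" and R: "0 \<le> R" and t: "0 < t"
    and u: "\<And>N. derivs_le N (\<lambda>m x. E m * inverse t ^ m * indicator (cball x0 (R * t)) x) u"
    and M: "grand_maximal F \<gamma> (distribution_of \<mu>) x0 \<le> ereal l"
  shows "norm (signed_integral \<mu> (\<lambda>y. complex_of_real (u y)))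
    \<le> seminorm_bound F E R * l * t powr (real DIM('a) - \<gamma>)"
proof -
  define A where "A = seminorm_bound F E R"
  have nn: "0 \<le> (1 + R) ^ p * (\<Sum>m\<le>q. E m)" for p q
    using R E by (intro mult_nonneg_nonneg sum_nonneg) auto
  have A1: "1 \<le> A" unfolding A_def by (rule seminorm_bound_ge_1[OF E R])
  define v where "v = (\<lambda>z. inverse A * u ((-t) *\<^sub>R z + x0))"
  define \<Phi> where "\<Phi> = (\<lambda>z. complex_of_real (v z))"
  have v: "derivs_le N (\<lambda>m z. (E m / A) * indicator (cball 0 R) z) v" for N
    unfolding v_def
  proof (rule derivs_le_mono[OF derivs_le_cmult[OF derivs_le_affine[OF u]]])
    fix m and z :: 'a
    have "((-t) *\<^sub>R z + x0 \<in> cball x0 (R * t)) = (z \<in> cball 0 R)"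
      using t by (simp add: dist_norm mult.commute)
    moreover have "t ^ m * inverse t ^ m = 1"
      using t by (simp flip: power_mult_distrib)
    ultimately show "\<bar>inverse A\<bar> * (\<bar>- t\<bar> ^ m * (E m * inverse t ^ m *
        indicator (cball x0 (R * t)) ((-t) *\<^sub>R z + x0))) \<le> E m / A * indicator (cball 0 R) z"
      using t A1 by (simp add: indicator_def field_simps)
  qed
  have EA: "0 \<le> E m / A" for m using E[of m] A1 by simp
  note sch = schwartz_of_compact_derivs_le[OF v R EA, folded \<Phi>_def]
  have "schwartz_seminorm p q \<Phi> \<le> 1" if "(p, q) \<in> F" for p q
  proof -
    have "(1 + R) ^ p * (\<Sum>m\<le>q. E m) \<le> (\<Sum>(p, q)\<in>F. (1 + R) ^ p * (\<Sum>m\<le>q. E m))"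
      using member_le_sum[OF that, of "\<lambda>(p, q). (1 + R) ^ p * (\<Sum>m\<le>q. E m)"] nn F by auto
    then have "(1 + R) ^ p * (\<Sum>m\<le>q. E m / A) \<le> 1"
      using A1 by (simp add: A_def seminorm_bound_def field_simps flip: sum_divide_distrib)
    then show ?thesis
      using order_trans[OF sch(1) ennreal_leI, of p q 1] by simp
  qed
  then have norm1: "schwartz_norm F \<Phi> \<le> 1"
    unfolding schwartz_norm_def by (auto intro!: SUP_least)
  let ?c = "inverse (t ^ DIM('a)) * inverse A"
  have "ereal (t powr \<gamma> * norm (convolution (distribution_of \<mu>) (dilation t \<Phi>) x0))
      \<le> grand_maximal F \<gamma> (distribution_of \<mu>) x0"
    unfolding grand_maximal_def
    using t sch(2) norm1 by (intro SUP_upper2[of "(t, \<Phi>)"]) auto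
  also have "convolution (distribution_of \<mu>) (dilation t \<Phi>) x0 =
      complex_of_real ?c * signed_integral \<mu> (\<lambda>y. complex_of_real (u y))"
  proof -
    have "dilation t \<Phi> (x0 - y) = complex_of_real ?c * complex_of_real (u y)" for y
      using t by (simp add: dilation_def \<Phi>_def v_def)
    then show ?thesis
      by (simp add: convolution_def distribution_of_def signed_integral_mult_left)
  qed
  also note M
  finally have "t powr \<gamma> * (?c * norm (signed_integral \<mu> (\<lambda>y. complex_of_real (u y)))) \<le> l"
    using t A1 by (simp add: norm_mult norm_inverse norm_power)
  moreover have "t powr \<gamma> * inverse (t ^ DIM('a)) = inverse (t powr (real DIM('a) - \<gamma>))"
    using t by (simp add: powr_diff powr_realpow inverse_eq_divide)
  ultimately have "inverse (t powr (real DIM('a) - \<gamma>)) * inverse A *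
      norm (signed_integral \<mu> (\<lambda>y. complex_of_real (u y))) \<le> l"
    by (simp add: mult.assoc[symmetric])
  then show ?thesis
    using t A1 unfolding A_def[symmetric] by (simp add: field_simps)
qed

section \<open>Signed measures\<close>

lemma signed_measure_sums:
  "signed_measure \<mu> \<Longrightarrow> range A \<subseteq> sets borel \<Longrightarrow> disjoint_family A \<Longrightarrow> (\<lambda>i::nat. \<mu> (A i)) sums \<mu> (\<Union>i. A i)"
  by (auto simp: signed_measure_def)

lemma signed_measure_Un:
  assumes "signed_measure \<mu>" "A \<in> sets borel" "B \<in> sets borel" "A \<inter> B = {}"
  shows "\<mu> (A \<union> B) = \<mu> A + \<mu> B"
proof -
  have "(\<lambda>i. \<mu> (binaryset A B i)) sums \<mu> (\<Union>i. binaryset A B i)"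
    by (rule signed_measure_sums)
       (use assms in \<open>auto simp: range_binaryset_eq disjoint_family_on_def binaryset_def\<close>)
  moreover have "(\<lambda>i. \<mu> (binaryset A B i)) sums (\<mu> A + \<mu> B)"
    by (rule binaryset_sums) (use assms in \<open>simp add: signed_measure_def\<close>)
  ultimately show ?thesis by (simp add: UN_binaryset_eq sums_unique2)
qed

lemma signed_measure_Diff:
  assumes "signed_measure \<mu>" "A \<in> sets borel" "B \<in> sets borel" "A \<subseteq> B"
  shows "\<mu> (B - A) = \<mu> B - \<mu> A"
proof -
  have "A \<union> (B - A) = B" using assms(4) by auto
  then show ?thesis using signed_measure_Un[OF assms(1,2), of "B - A"] assms by simp
qed

text \<open>
  A real-valued countably additive set function is bounded.  Otherwise a set of infinite positive
  variation could be shrunk again and again, keeping infinite positive variation and each time splitting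
  off a set of measure at least 1 in absolute value; the disjoint sets split off would contradict the
  convergence of the series of their measures.
\<close>

lemma finite_positive_part:
  assumes \<mu>: "signed_measure \<mu>"
  shows "finite_measure (positive_part \<mu>)"
proof (rule finite_measureI, rule notI)
  let ?P = "positive_part \<mu>"
  assume "emeasure ?P (space ?P) = \<infinity>"
  then have top: "emeasure ?P UNIV = \<infinity>" by simp
  have split: "\<exists>F. (F \<in> sets borel \<and> emeasure ?P F = \<infinity>) \<and> F \<subseteq> E \<and> 1 \<le> \<bar>\<mu> (E - F)\<bar>"
    if E: "E \<in> sets borel \<and> emeasure ?P E = \<infinity>" for E
  proof -
    have "ennreal (1 + \<bar>\<mu> E\<bar>) < (SUP A \<in> {A \<in> sets borel. A \<subseteq> E}. ennreal (\<mu> A))"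
      using E emeasure_positive_part[OF \<mu>, of E] by simp
    then obtain A where A: "A \<in> sets borel" "A \<subseteq> E" "ennreal (1 + \<bar>\<mu> E\<bar>) < ennreal (\<mu> A)"
      by (auto simp: less_SUP_iff)
    then have big: "1 + \<bar>\<mu> E\<bar> < \<mu> A"
      by (meson ennreal_leI leD leI)
    have "emeasure ?P E = emeasure ?P A + emeasure ?P (E - A)"
    proof -
      have "A \<union> (E - A) = E" "E - A \<in> sets borel" using A E by auto
      then show ?thesis using plus_emeasure[of A ?P "E - A"] A(1) by simp
    qed
    then consider "emeasure ?P A = \<infinity>" | "emeasure ?P (E - A) = \<infinity>"
      using E by (metis ennreal_add_eq_top infinity_ennreal_def)
    then show ?thesis
    proof cases
      case 1
      then show ?thesis
        using A big signed_measure_Diff[OF \<mu> A(1) _ A(2)] E by (intro exI[of _ A]) auto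
    next
      case 2
      moreover have "E - (E - A) = A" using A(2) by auto
      ultimately show ?thesis using A big E by (intro exI[of _ "E - A"]) auto
    qed
  qed
  have "\<exists>F :: nat \<Rightarrow> 'a set. \<forall>n. (F n \<in> sets borel \<and> emeasure ?P (F n) = \<infinity>) \<and>
      F (Suc n) \<subseteq> F n \<and> 1 \<le> \<bar>\<mu> (F n - F (Suc n))\<bar>"
  proof (rule dependent_nat_choice)
    show "\<exists>E. E \<in> sets borel \<and> emeasure ?P E = \<infinity>"
      using top by (intro exI[of _ UNIV]) simp
  qed (use split in blast)
  then obtain F :: "nat \<Rightarrow> 'a set" where F: "\<And>n. F n \<in> sets borel" "\<And>n. F (Suc n) \<subseteq> F n"
    "\<And>n. 1 \<le> \<bar>\<mu> (F n - F (Suc n))\<bar>" by blast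
  have dec: "F n \<subseteq> F m" if "m \<le> n" for m n
    using that by (rule lift_Suc_antimono_le[of F, OF F(2)])
  have "disjoint_family (\<lambda>n. F n - F (Suc n))"
    unfolding disjoint_family_on_def
  proof (intro ballI impI)
    fix m n :: nat assume "m \<noteq> n"
    then consider "Suc m \<le> n" | "Suc n \<le> m" by linarith
    then show "(F m - F (Suc m)) \<inter> (F n - F (Suc n)) = {}"
      by cases (use dec in blast)+
  qed
  then have "(\<lambda>n. \<mu> (F n - F (Suc n))) sums \<mu> (\<Union>n. F n - F (Suc n))"
    using F(1) by (intro signed_measure_sums \<mu>) auto
  then have "(\<lambda>n. \<mu> (F n - F (Suc n))) \<longlonglongrightarrow> 0"
    using sums_summable summable_LIMSEQ_zero by blast
  then obtain n where "\<bar>\<mu> (F n - F (Suc n))\<bar> < 1"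
    using LIMSEQ_D[of _ 0 1] by force
  with F(3)[of n] show False by simp
qed

lemma measure_positive_part_ge:
  assumes \<mu>: "signed_measure \<mu>" and "A \<in> sets borel" "E \<in> sets borel" "A \<subseteq> E"
  shows "\<mu> A \<le> measure (positive_part \<mu>) E"
proof -
  interpret finite_measure "positive_part \<mu>" by (rule finite_positive_part[OF \<mu>])
  have "ennreal (\<mu> A) \<le> ennreal (measure (positive_part \<mu>) E)"
    using assms by (auto simp flip: emeasure_eq_measure simp: emeasure_positive_part intro!: SUP_upper)
  then show ?thesis by (simp add: ennreal_le_iff)
qed

lemma measure_positive_part_le:
  assumes \<mu>: "signed_measure \<mu>" and E: "E \<in> sets borel" and "0 \<le> c"
    and le: "\<And>A. A \<in> sets borel \<Longrightarrow> A \<subseteq> E \<Longrightarrow> \<mu> A \<le> c"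
  shows "measure (positive_part \<mu>) E \<le> c"
proof -
  interpret finite_measure "positive_part \<mu>" by (rule finite_positive_part[OF \<mu>])
  have "ennreal (measure (positive_part \<mu>) E) \<le> ennreal c"
    using le by (auto simp flip: emeasure_eq_measure simp: emeasure_positive_part[OF \<mu> E]
        intro!: SUP_least ennreal_leI)
  then show ?thesis using assms by simp
qed

text \<open>
  For \<open>A \<subseteq> E\<close> one has \<open>\<mu> A = \<mu> E - \<mu> (E - A)\<close>; take the supremum over \<open>A\<close>.
\<close>

lemma jordan_decomposition_le:
  assumes \<mu>: "signed_measure \<mu>" and E: "E \<in> sets borel"
  shows "measure (positive_part \<mu>) E \<le> \<mu> E + measure (negative_part \<mu>) E"
proof (rule measure_positive_part_le[OF \<mu> E])
  have neg: "- \<mu> A \<le> measure (negative_part \<mu>) E" if "A \<in> sets borel" "A \<subseteq> E" for A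
    using measure_positive_part_ge[OF signed_measure_uminus[OF \<mu>] that(1) E that(2)]
    by (simp add: negative_part_def)
  show "0 \<le> \<mu> E + measure (negative_part \<mu>) E" using neg[of E] E by simp
  show "\<mu> A \<le> \<mu> E + measure (negative_part \<mu>) E" if "A \<in> sets borel" "A \<subseteq> E" for A
    using neg[of "E - A"] signed_measure_Diff[OF \<mu> that(1) E that(2)] E that by simp
qed

lemma jordan_decomposition:
  assumes \<mu>: "signed_measure \<mu>" and E: "E \<in> sets borel"
  shows "\<mu> E = measure (positive_part \<mu>) E - measure (negative_part \<mu>) E"
  using jordan_decomposition_le[OF \<mu> E] jordan_decomposition_le[OF signed_measure_uminus[OF \<mu>] E]
  by (simp add: negative_part_def)

lemma finite_negative_part: "signed_measure \<mu> \<Longrightarrow> finite_measure (negative_part \<mu>)"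
  unfolding negative_part_def by (intro finite_positive_part signed_measure_uminus)

lemma sets_negative_part [simp]: "sets (negative_part \<mu>) = sets borel"
  by (simp add: negative_part_def)

lemma integrable_bounded_continuous:
  fixes f :: "'a::topological_space \<Rightarrow> 'b::{banach, second_countable_topology}"
  assumes "finite_measure M" "sets M = sets borel" "continuous_on UNIV f" "\<And>x. norm (f x) \<le> c"
  shows "integrable M f"
proof -
  interpret finite_measure M by fact
  have "f \<in> borel_measurable M"
    using assms(2,3) borel_measurable_continuous_onI measurable_cong_sets by blast
  then show ?thesis using assms(4) by (intro integrable_const_bound[of f c]) auto
qed

lemma signed_integral_sum:
  assumes \<mu>: "signed_measure \<mu>" and I: "finite I"
    and f: "\<And>i. i \<in> I \<Longrightarrow> continuous_on UNIV (f i)" "\<And>i x. i \<in> I \<Longrightarrow> norm (f i x) \<le> c i"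
  shows "signed_integral \<mu> (\<lambda>x. \<Sum>i\<in>I. f i x) = (\<Sum>i\<in>I. signed_integral \<mu> (f i))"
proof -
  have "integrable (positive_part \<mu>) (f i)" "integrable (negative_part \<mu>) (f i)" if "i \<in> I" for i
    using integrable_bounded_continuous[OF finite_positive_part[OF \<mu>] _ f[OF that]]
      integrable_bounded_continuous[OF finite_negative_part[OF \<mu>] _ f[OF that]] by auto
  then show ?thesis
    by (simp add: signed_integral_def sum_subtractf)
qed

lemma signed_integral_tendsto_indicator:
  fixes u :: "nat \<Rightarrow> 'a::topological_space \<Rightarrow> real"
  assumes \<mu>: "signed_measure \<mu>" and K: "K \<in> sets borel"
    and u: "\<And>n. continuous_on UNIV (u n)" "\<And>n x. \<bar>u n x\<bar> \<le> 1"
    and lim: "\<And>x. (\<lambda>n. u n x) \<longlonglongrightarrow> indicator K x"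
  shows "(\<lambda>n. signed_integral \<mu> (\<lambda>x. complex_of_real (u n x))) \<longlonglongrightarrow> complex_of_real (\<mu> K)"
proof -
  have *: "(\<lambda>n. integral\<^sup>L M (\<lambda>x. complex_of_real (u n x))) \<longlonglongrightarrow> complex_of_real (measure M K)"
    if M: "finite_measure M" "sets M = sets borel" for M
  proof -
    interpret finite_measure M by fact
    have sp: "space M = UNIV" using sets_eq_imp_space_eq[OF M(2)] by simp
    have "(\<lambda>n. integral\<^sup>L M (\<lambda>x. complex_of_real (u n x))) \<longlonglongrightarrow>
        integral\<^sup>L M (\<lambda>x. complex_of_real (indicator K x))"
    proof (rule integral_dominated_convergence[where w="\<lambda>_. 1"])
      show "(\<lambda>x. complex_of_real (indicator K x)) \<in> borel_measurable M"
        using K M(2) by measurable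
      have "u n \<in> borel_measurable M" for n
        using M(2) u(1) borel_measurable_continuous_onI measurable_cong_sets by blast
      then show "(\<lambda>x. complex_of_real (u n x)) \<in> borel_measurable M" for n
        by measurable
    qed (use u(2) lim in \<open>auto intro!: tendsto_of_real\<close>)
    also have "integral\<^sup>L M (\<lambda>x. complex_of_real (indicator K x)) = complex_of_real (measure M K)"
      by (simp only: integral_complex_of_real) (use K M(2) sp in simp)
    finally show ?thesis .
  qed
  show ?thesis
    unfolding signed_integral_def jordan_decomposition[OF \<mu> K] of_real_diff
    by (intro tendsto_diff *) (simp_all add: finite_positive_part finite_negative_part \<mu>)
qed

text \<open>
  One compact set approximates \<open>E\<close> from inside for both Jordan parts at once.
\<close>

lemma signed_measure_eq_0_if_compact:
  fixes \<mu> :: "'a::euclidean_space set \<Rightarrow> real"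
  assumes \<mu>: "signed_measure \<mu>" and E: "E \<in> sets borel"
    and K: "\<And>K. compact K \<Longrightarrow> K \<subseteq> E \<Longrightarrow> \<mu> K = 0"
  shows "\<mu> E = 0"
proof (rule ccontr)
  assume "\<mu> E \<noteq> 0"
  define e where "e = \<bar>\<mu> E\<bar> / 2"
  have e: "0 < e" using \<open>\<mu> E \<noteq> 0\<close> by (simp add: e_def)
  have approx: "\<exists>K. compact K \<and> K \<subseteq> E \<and> measure M E - e < measure M K"
    if M: "finite_measure M" "sets M = sets borel" for M
  proof -
    interpret finite_measure M by fact
    show ?thesis
    proof (rule ccontr)
      assume "\<not> ?thesis"
      then have le: "measure M K \<le> measure M E - e" if "compact K" "K \<subseteq> E" for K
        using that by (auto simp: not_less)
      have "emeasure M E = (SUP K \<in> {K. K \<subseteq> E \<and> compact K}. emeasure M K)"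
        using inner_regular[OF M(2) _ E] emeasure_finite by auto
      also have "\<dots> \<le> ennreal (measure M E - e)"
        by (rule SUP_least) (auto simp: emeasure_eq_measure intro!: ennreal_leI le)
      finally have "measure M E \<le> measure M E - e"
        using le[of "{}"] by (simp add: emeasure_eq_measure)
      with e show False by simp
    qed
  qed
  obtain K1 where K1: "compact K1" "K1 \<subseteq> E" "measure (positive_part \<mu>) E - e < measure (positive_part \<mu>) K1"
    using approx[of "positive_part \<mu>"] finite_positive_part[OF \<mu>] by auto
  obtain K2 where K2: "compact K2" "K2 \<subseteq> E" "measure (negative_part \<mu>) E - e < measure (negative_part \<mu>) K2"
    using approx[of "negative_part \<mu>"] finite_negative_part[OF \<mu>] by auto
  let ?K = "K1 \<union> K2"
  have Kb: "?K \<in> sets borel" "K1 \<in> sets borel" "K2 \<in> sets borel"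
    using K1 K2 by (auto intro!: borel_compact)
  have "\<mu> (E - ?K) = \<mu> E"
    using signed_measure_Diff[OF \<mu> Kb(1) E] K[of ?K] K1 K2 by auto
  moreover have "measure M (E - ?K) < e"
    if M: "finite_measure M" "sets M = sets borel" "L \<in> sets borel" "L \<subseteq> ?K" "measure M E - e < measure M L" for M L
  proof -
    interpret finite_measure M by fact
    have "measure M (E - ?K) = measure M E - measure M ?K"
      using M E Kb K1 K2 by (intro finite_measure_Diff) auto
    moreover have "measure M L \<le> measure M ?K"
      using M Kb by (intro finite_measure_mono) auto
    ultimately show ?thesis using M(5) by linarith
  qed
  from this[of "positive_part \<mu>" K1] this[of "negative_part \<mu>" K2]
  have "measure (positive_part \<mu>) (E - ?K) < e" "measure (negative_part \<mu>) (E - ?K) < e"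
    using finite_positive_part[OF \<mu>] finite_negative_part[OF \<mu>] Kb K1 K2 by auto
  moreover have "\<mu> (E - ?K) = measure (positive_part \<mu>) (E - ?K) - measure (negative_part \<mu>) (E - ?K)"
    using E Kb by (intro jordan_decomposition \<mu>) auto
  ultimately have "\<bar>\<mu> (E - ?K)\<bar> < e"
    using measure_nonneg[of "positive_part \<mu>" "E - ?K"] measure_nonneg[of "negative_part \<mu>" "E - ?K"]
    by linarith
  then show False using \<open>\<mu> (E - ?K) = \<mu> E\<close> e by (simp add: e_def)
qed

lemma total_variation_eq_0:
  assumes "\<And>A. A \<in> sets borel \<Longrightarrow> A \<subseteq> E \<Longrightarrow> \<mu> A = 0"
  shows "total_variation \<mu> E = 0"
proof -
  have "(\<Sum>A\<in>P. ennreal \<bar>\<mu> A\<bar>) \<le> 0"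
    if "finite P" "disjoint P" "P \<subseteq> sets borel" "\<Union> P = E" for P
    using that assms by (intro eq_refl sum.neutral) auto
  then show ?thesis
    unfolding total_variation_def by (intro antisym SUP_least) auto
qed

section \<open>Dyadic cubes and the stopping-time selection\<close>

text \<open>
  The cube of side \<open>2\<^sup>-\<^sup>k\<close> with index \<open>n\<close> is the level set of \<open>cell k\<close> at \<open>n\<close>.  In this form the half-open dyadic
  cubes of one scale are disjoint by definition, and nestedness says that \<open>cell k\<close> determines \<open>cell j\<close> for
  \<open>j \<le> k\<close>.
\<close>

definition cell :: "nat \<Rightarrow> 'a::euclidean_space \<Rightarrow> 'a \<Rightarrow> int" where
  "cell k x = (\<lambda>i\<in>Basis. \<lfloor>2 ^ k * (x \<bullet> i)\<rfloor>)"

definition cube :: "nat \<times> ('a::euclidean_space \<Rightarrow> int) \<Rightarrow> 'a set" where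
  "cube p = {x. cell (fst p) x = snd p}"

text \<open>
  The total of the side lengths to the power \<open>\<beta>\<close>, as a measure on sets of cubes: infinite families and
  countable subadditivity then come for free.
\<close>

definition cube_measure :: "real \<Rightarrow> (nat \<times> ('a \<Rightarrow> int)) measure" where
  "cube_measure \<beta> = density (count_space UNIV) (\<lambda>p. ennreal ((1 / 2 ^ fst p) powr \<beta>))"

lemma sets_cube_measure [simp]: "sets (cube_measure \<beta>) = UNIV"
  by (simp add: cube_measure_def)

lemma emeasure_cube_measure:
  "emeasure (cube_measure \<beta>) C = (\<integral>\<^sup>+p. ennreal ((1 / 2 ^ fst p) powr \<beta>) \<partial>count_space C)"
  by (simp add: cube_measure_def emeasure_density nn_integral_count_space_indicator)

lemma emeasure_cube_measure_finite:
  "finite C \<Longrightarrow> emeasure (cube_measure \<beta>) C = ennreal (\<Sum>p\<in>C. (1 / 2 ^ fst p) powr \<beta>)"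
  by (simp add: emeasure_cube_measure nn_integral_count_space_finite)

lemma mem_cube_iff:
  "x \<in> cube p \<longleftrightarrow> snd p \<in> (\<Pi>\<^sub>E i\<in>Basis. UNIV) \<and>
     (\<forall>i\<in>Basis. of_int (snd p i) \<le> 2 ^ fst p * (x \<bullet> i) \<and> 2 ^ fst p * (x \<bullet> i) < of_int (snd p i) + 1)"
proof -
  have "cell (fst p) x = snd p \<longleftrightarrow> snd p \<in> (\<Pi>\<^sub>E i\<in>Basis. UNIV) \<and>
      (\<forall>i\<in>Basis. \<lfloor>2 ^ fst p * (x \<bullet> i)\<rfloor> = snd p i)"
    by (auto simp: cell_def PiE_def extensional_def fun_eq_iff)
  then show ?thesis by (simp add: cube_def floor_eq_iff)
qed

lemma mem_cubeD:
  assumes "x \<in> cube p" "i \<in> Basis"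
  shows "of_int (snd p i) \<le> 2 ^ fst p * (x \<bullet> i)" "2 ^ fst p * (x \<bullet> i) < of_int (snd p i) + 1"
  using assms by (simp_all add: mem_cube_iff)

lemma mem_cube_cell: "x \<in> cube (k, cell k x)"
  by (simp add: cube_def)

lemma cell_indices: "cell k x \<in> (\<Pi>\<^sub>E i\<in>Basis. UNIV)"
  by (simp add: cell_def)

lemma cell_coarsen:
  assumes "j \<le> k" "cell k x = cell k y"
  shows "cell j x = cell j y"
proof -
  have *: "\<lfloor>2 ^ j * s\<rfloor> = \<lfloor>2 ^ k * s\<rfloor> div 2 ^ (k - j)" for s :: real
  proof -
    have "(2::real) ^ k = 2 ^ j * 2 ^ (k - j)" using assms(1) by (simp flip: power_add)
    then have "2 ^ j * s = (2 ^ k * s) / real_of_int (2 ^ (k - j))" by simp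
    then show ?thesis by (metis floor_divide_real_eq_div zero_le_numeral zero_le_power)
  qed
  show ?thesis
    unfolding cell_def
  proof (rule restrict_ext)
    fix i :: 'a assume i: "i \<in> Basis"
    have "\<lfloor>2 ^ k * (x \<bullet> i)\<rfloor> = \<lfloor>2 ^ k * (y \<bullet> i)\<rfloor>"
      using fun_cong[OF assms(2), of i] i by (simp add: cell_def)
    then show "\<lfloor>2 ^ j * (x \<bullet> i)\<rfloor> = \<lfloor>2 ^ j * (y \<bullet> i)\<rfloor>" by (simp add: *)
  qed
qed

lemma cube_subset:
  assumes "x \<in> cube p" "x \<in> cube q" "fst p \<le> fst q"
  shows "cube q \<subseteq> cube p"
proof
  fix z assume "z \<in> cube q"
  with assms(2) have "cell (fst q) z = cell (fst q) x" by (simp add: cube_def)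
  from cell_coarsen[OF assms(3) this] assms(1) show "z \<in> cube p" by (simp add: cube_def)
qed

lemma borel_cube [measurable]: "cube p \<in> sets borel"
proof -
  have "cube p = (if snd p \<in> (\<Pi>\<^sub>E i\<in>Basis. UNIV) then
     (\<Inter>i\<in>Basis. {x. of_int (snd p i) \<le> 2 ^ fst p * (x \<bullet> i) \<and> 2 ^ fst p * (x \<bullet> i) < of_int (snd p i) + 1}) else {})"
    by (auto simp: mem_cube_iff)
  also have "\<dots> \<in> sets borel" by (auto intro!: sets.finite_INT)
  finally show ?thesis .
qed

lemma emeasure_cube:
  assumes "n \<in> (\<Pi>\<^sub>E i\<in>Basis. UNIV)"
  shows "emeasure lborel (cube (k, n) :: 'a::euclidean_space set) = ennreal ((1 / 2 ^ k) ^ DIM('a))"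
proof -
  define a b :: 'a where "a = (\<Sum>i\<in>Basis. (of_int (n i) / 2 ^ k) *\<^sub>R i)"
    and "b = (\<Sum>i\<in>Basis. ((of_int (n i) + 1) / 2 ^ k) *\<^sub>R i)"
  have ab: "a \<bullet> i = of_int (n i) / 2 ^ k" "b \<bullet> i = (of_int (n i) + 1) / 2 ^ k" if "i \<in> Basis" for i
    using that by (simp_all add: a_def b_def inner_sum_left inner_Basis if_distrib cong: if_cong)
  have le: "a \<bullet> i \<le> b \<bullet> i" if "i \<in> Basis" for i
    using ab[OF that] by (simp add: divide_right_mono)
  have vol: "(\<Prod>i\<in>Basis. (b - a) \<bullet> i) = (1 / 2 ^ k) ^ DIM('a)"
    by (simp add: inner_diff_left ab flip: diff_divide_distrib)
  have "box a b \<subseteq> cube (k, n)"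
    using assms by (auto simp: mem_cube_iff mem_box ab field_simps less_imp_le)
  moreover have "cube (k, n) \<subseteq> cbox a b"
    by (auto simp: mem_cube_iff mem_box ab field_simps less_imp_le)
  ultimately have "emeasure lborel (box a b) \<le> emeasure lborel (cube (k, n))"
    "emeasure lborel (cube (k, n)) \<le> emeasure lborel (cbox a b)"
    by (auto intro!: emeasure_mono)
  then show ?thesis
    using emeasure_lborel_box[OF le] emeasure_lborel_cbox[OF le] vol by (intro antisym) auto
qed

lemma emeasure_UN_le_count_space:
  assumes "countable I" "\<And>i. i \<in> I \<Longrightarrow> A i \<in> sets M"
  shows "emeasure M (\<Union>i\<in>I. A i) \<le> (\<integral>\<^sup>+i. emeasure M (A i) \<partial>count_space I)"
proof -
  have "emeasure M (\<Union>i\<in>I. A i) = (\<integral>\<^sup>+x. indicator (\<Union>i\<in>I. A i) x \<partial>M)"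
    using assms by (intro nn_integral_indicator[symmetric] sets.countable_UN'') auto
  also have "\<dots> \<le> (\<integral>\<^sup>+x. \<integral>\<^sup>+i. indicator (A i) x \<partial>count_space I \<partial>M)"
  proof (rule nn_integral_mono)
    fix x
    show "indicator (\<Union>i\<in>I. A i) x \<le> (\<integral>\<^sup>+i. indicator (A i) x \<partial>count_space I :: ennreal)"
    proof (cases "x \<in> (\<Union>i\<in>I. A i)")
      case True
      then obtain i where "i \<in> I" "x \<in> A i" by blast
      then show ?thesis
        using nn_integral_ge_point[of i I "\<lambda>i. indicator (A i) x"] True by simp
    qed simp
  qed
  also have "\<dots> = (\<integral>\<^sup>+i. \<integral>\<^sup>+x. indicator (A i) x \<partial>M \<partial>count_space I)"
    using assms by (intro nn_integral_count_space_nn_integral) auto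
  also have "\<dots> = (\<integral>\<^sup>+i. emeasure M (A i) \<partial>count_space I)"
    using assms by (intro nn_integral_cong) auto
  finally show ?thesis .
qed

text \<open>
  Compare Lebesgue measures: subcubes of side \<open>r \<le> l\<close> satisfy \<open>r\<^sup>d \<le> l\<^sup>d\<^sup>-\<^sup>\<beta> r\<^sup>\<beta>\<close>.
\<close>

lemma cube_le_subcubes:
  fixes p :: "nat \<times> ('a::euclidean_space \<Rightarrow> int)"
  assumes \<beta>: "\<beta> \<le> real DIM('a)" and p: "snd p \<in> (\<Pi>\<^sub>E i\<in>Basis. UNIV)"
    and S: "countable S" "\<And>q. q \<in> S \<Longrightarrow> fst p \<le> fst q \<and> snd q \<in> (\<Pi>\<^sub>E i\<in>Basis. UNIV)"
    and cover: "cube p \<subseteq> (\<Union>q\<in>S. cube q)"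
  shows "ennreal ((1 / 2 ^ fst p) powr \<beta>) \<le> emeasure (cube_measure \<beta>) S"
proof -
  let ?l = "1 / 2 ^ fst p :: real" and ?d = "real DIM('a)"
  have "ennreal (?l ^ DIM('a)) = emeasure lborel (cube p)"
    using emeasure_cube[of "snd p" "fst p"] p by simp
  also have "\<dots> \<le> emeasure lborel (\<Union>q\<in>S. cube q)"
    using S(1) by (intro emeasure_mono cover sets.countable_UN'') auto
  also have "\<dots> \<le> (\<integral>\<^sup>+q. emeasure lborel (cube q) \<partial>count_space S)"
    by (rule emeasure_UN_le_count_space) (use S in auto)
  also have "\<dots> \<le> (\<integral>\<^sup>+q. ennreal (?l powr (?d - \<beta>)) * ennreal ((1 / 2 ^ fst q) powr \<beta>) \<partial>count_space S)"
  proof (rule nn_integral_mono)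
    fix q assume "q \<in> space (count_space S)"
    then have q: "fst p \<le> fst q" "snd q \<in> (\<Pi>\<^sub>E i\<in>Basis. UNIV)" using S by auto
    let ?r = "1 / 2 ^ fst q :: real"
    have "?r ^ DIM('a) = ?r powr ((?d - \<beta>) + \<beta>)"
      by (simp add: powr_realpow)
    also have "\<dots> = ?r powr (?d - \<beta>) * ?r powr \<beta>" by (rule powr_add)
    also have "\<dots> \<le> ?l powr (?d - \<beta>) * ?r powr \<beta>"
      using q(1) \<beta> by (intro mult_right_mono powr_mono2) (auto simp: field_simps)
    finally show "emeasure lborel (cube q) \<le> ennreal (?l powr (?d - \<beta>)) * ennreal (?r powr \<beta>)"
      using emeasure_cube[OF q(2), of "fst q"] by (simp add: ennreal_leI flip: ennreal_mult)
  qed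
  also have "\<dots> = ennreal (?l powr (?d - \<beta>)) * emeasure (cube_measure \<beta>) S"
    by (simp add: emeasure_cube_measure nn_integral_cmult)
  finally have "ennreal (?l powr (?d - \<beta>) * ?l powr \<beta>) \<le> ennreal (?l powr (?d - \<beta>)) * emeasure (cube_measure \<beta>) S"
    by (simp add: powr_realpow flip: powr_add)
  then have "ennreal (?l powr (?d - \<beta>)) * ennreal (?l powr \<beta>) \<le> ennreal (?l powr (?d - \<beta>)) * emeasure (cube_measure \<beta>) S"
    by (simp add: ennreal_mult)
  then show ?thesis
    by (subst (asm) ennreal_mult_le_mult_iff) auto
qed

text \<open>
  From a cover \<open>C\<close> of \<open>K \<union> U\<close>, obtain a cover of \<open>K\<close> by cubes near the complement of \<open>U\<close> at the cost of a
  factor 2.  A point of \<open>K\<close> in some cube of \<open>C\<close> that sticks out of \<open>U\<close> is covered by that cube.  Any other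
  point \<open>x\<close> lies in a largest dyadic cube inside \<open>U\<close>.  That cube is covered by cubes of \<open>C\<close> inside it, because
  a larger one would contain \<open>x\<close>, hence lie inside \<open>U\<close>, against maximality.  In an application \<open>U\<close> is the set
  where a maximal function is large.
\<close>

lemma stopping_cubes:
  fixes K U :: "'a::euclidean_space set"
  assumes \<beta>: "0 < \<beta>" "\<beta> \<le> real DIM('a)"
    and C: "countable C" "\<And>q. q \<in> C \<Longrightarrow> snd q \<in> (\<Pi>\<^sub>E i\<in>Basis. UNIV)"
    and cover: "K \<subseteq> (\<Union>q\<in>C. cube q)" "U \<subseteq> (\<Union>q\<in>C. cube q)"
    and small: "emeasure (cube_measure \<beta>) C < 1"
  obtains G where "\<And>p. p \<in> G \<Longrightarrow> snd p \<in> (\<Pi>\<^sub>E i\<in>Basis. UNIV)"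
    "K \<subseteq> (\<Union>p\<in>G. cube p)"
    "\<And>p. p \<in> G \<Longrightarrow> cube p \<inter> K \<noteq> {}"
    "\<And>p. p \<in> G \<Longrightarrow> \<exists>y. y \<notin> U \<and> (\<forall>i\<in>Basis. \<bar>2 ^ fst p * (y \<bullet> i) - of_int (snd p i)\<bar> \<le> 3)"
    "\<And>H. finite H \<Longrightarrow> H \<subseteq> G \<Longrightarrow>
        ennreal (\<Sum>p\<in>H. (1 / 2 ^ fst p) powr \<beta>) \<le> 2 * emeasure (cube_measure \<beta>) C"
proof -
  let ?\<rho> = "emeasure (cube_measure \<beta>)"
  let ?w = "\<lambda>p::nat \<times> ('a \<Rightarrow> int). (1 / 2 ^ fst p) powr \<beta>"
  \<comment> \<open>\<open>G1\<close>: cubes of the cover that stick out of \<open>U\<close>.  \<open>G2\<close>: the maximal cubes inside \<open>U\<close> around the other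
    points of \<open>K\<close>; each is charged to its own, pairwise disjoint, set \<open>sub p\<close> of cubes of the cover.\<close>
  define G1 where "G1 = {p \<in> C. \<not> cube p \<subseteq> U \<and> cube p \<inter> K \<noteq> {}}"
  define top where "top j x \<longleftrightarrow> cube (j, cell j x) \<subseteq> U \<and> (\<forall>j'<j. \<not> cube (j', cell j' x) \<subseteq> U) \<and>
     (\<forall>q\<in>C. x \<in> cube q \<longrightarrow> cube q \<subseteq> U)" for j and x :: 'a
  define G2 where "G2 = {(j, cell j x) | j x. x \<in> K \<and> top j x}"
  define sub where "sub p = {q \<in> C. fst p \<le> fst q \<and> cube q \<subseteq> cube p \<and> cube q \<noteq> {}}" for p
  have sub_C: "sub p \<subseteq> C" for p by (auto simp: sub_def)
  have w_sub: "ennreal (?w p) \<le> ?\<rho> (sub p)" if p: "p \<in> G2" for p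
  proof -
    obtain j x where x: "p = (j, cell j x)" "x \<in> K" "top j x"
      using p by (auto simp: G2_def)
    have "cube p \<subseteq> (\<Union>q\<in>sub p. cube q)"
    proof
      fix z assume z: "z \<in> cube p"
      then have "z \<in> U" using x by (auto simp: top_def)
      then obtain q where q: "q \<in> C" "z \<in> cube q" using cover(2) by blast
      have "j \<le> fst q"
      proof (rule ccontr)
        assume lt: "\<not> j \<le> fst q"
        then have "cube p \<subseteq> cube q"
          using cube_subset[OF q(2) z] x(1) by auto
        then have "x \<in> cube q" using x(1) mem_cube_cell by blast
        then have "cube (fst q, cell (fst q) x) = cube q" "cube q \<subseteq> U"
          using x(3) q(1) by (auto simp: top_def cube_def)
        then show False using x(3) lt unfolding top_def by (metis not_le)
      qed
      then have "q \<in> sub p"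
        using q z cube_subset[OF z q(2)] x(1) by (auto simp: sub_def)
      with q(2) show "z \<in> (\<Union>q\<in>sub p. cube q)" by blast
    qed
    then show ?thesis
      using C x(1) sub_C[of p]
      by (intro cube_le_subcubes \<beta>) (auto simp: cell_indices sub_def intro: countable_subset[OF sub_C])
  qed
  have disj: "sub p \<inter> sub p' = {}" if "p \<in> G2" "p' \<in> G2" "p \<noteq> p'" for p p'
  proof -
    have no: False if p: "p \<in> G2" "p' \<in> G2" "p \<noteq> p'" "fst p \<le> fst p'" and q: "q \<in> sub p" "q \<in> sub p'" for p p' q
    proof -
      obtain z where z: "z \<in> cube q" using q(1) by (auto simp: sub_def)
      then have zz: "z \<in> cube p" "z \<in> cube p'" using q by (auto simp: sub_def)
      obtain j x where x: "p' = (j, cell j x)" "top j x" using p(2) by (auto simp: G2_def)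
      have "cube p' \<subseteq> cube p" by (rule cube_subset[OF zz p(4)])
      then have "x \<in> cube p" using x(1) mem_cube_cell by blast
      then have px: "p = (fst p, cell (fst p) x)" by (simp add: cube_def prod_eq_iff)
      moreover have "cube p \<subseteq> U" using p(1) by (auto simp: G2_def top_def)
      ultimately have "\<not> fst p < j" using x(2) unfolding top_def by metis
      then have "fst p = j" using p(4) x(1) by simp
      then show False using px x(1) p(3) by simp
    qed
    show ?thesis
    proof (rule ccontr)
      assume "\<not> ?thesis"
      then obtain q where "q \<in> sub p" "q \<in> sub p'" by blast
      then show False
        using no[OF that, of q] no[OF that(2,1) that(3)[symmetric], of q] linear[of "fst p" "fst p'"] by auto
    qed
  qed
  have sumG2: "ennreal (\<Sum>p\<in>H. ?w p) \<le> ?\<rho> C" if H: "finite H" "H \<subseteq> G2" for H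
  proof -
    have "ennreal (\<Sum>p\<in>H. ?w p) = (\<Sum>p\<in>H. ennreal (?w p))" by simp
    also have "\<dots> \<le> (\<Sum>p\<in>H. ?\<rho> (sub p))" using H w_sub by (intro sum_mono) auto
    also have "\<dots> = ?\<rho> (\<Union>p\<in>H. sub p)"
    proof (rule sum_emeasure)
      show "disjoint_family_on sub H"
        unfolding disjoint_family_on_def using H(2) disj by (meson subsetD)
    qed (use H in auto)
    also have "\<dots> \<le> ?\<rho> C" using sub_C by (intro emeasure_mono) auto
    finally show ?thesis .
  qed
  have sumG1: "ennreal (\<Sum>p\<in>H. ?w p) \<le> ?\<rho> C" if H: "finite H" "H \<subseteq> G1" for H
    using emeasure_cube_measure_finite[OF H(1), of \<beta>] emeasure_mono[of H C "cube_measure \<beta>"] H(2)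
    by (auto simp: G1_def)
  show thesis
  proof (rule that[of "G1 \<union> G2"])
    show "snd p \<in> (\<Pi>\<^sub>E i\<in>Basis. UNIV)" if "p \<in> G1 \<union> G2" for p
    proof (cases "p \<in> G1")
      case True
      then show ?thesis using C(2) unfolding G1_def by blast
    next
      case False
      with that show ?thesis unfolding G2_def using cell_indices by force
    qed
    show "cube p \<inter> K \<noteq> {}" if "p \<in> G1 \<union> G2" for p
      using that mem_cube_cell by (auto simp: G1_def G2_def)
    show "K \<subseteq> (\<Union>p\<in>G1 \<union> G2. cube p)"
    proof
      fix x assume x: "x \<in> K"
      show "x \<in> (\<Union>p\<in>G1 \<union> G2. cube p)"
      proof (cases "\<forall>q\<in>C. x \<in> cube q \<longrightarrow> cube q \<subseteq> U")
        case False
        then show ?thesis using x by (auto simp: G1_def)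
      next
        case True
        obtain q where "q \<in> C" "x \<in> cube q" using x cover(1) by blast
        then have "cube (fst q, cell (fst q) x) \<subseteq> U" using True by (auto simp: cube_def)
        then obtain j where "cube (j, cell j x) \<subseteq> U" "\<forall>j'<j. \<not> cube (j', cell j' x) \<subseteq> U"
          using exists_least_iff[of "\<lambda>j. cube (j, cell j x) \<subseteq> U"] by blast
        then have "(j, cell j x) \<in> G2" using x True by (auto simp: G2_def top_def)
        then show ?thesis using mem_cube_cell by blast
      qed
    qed
    show "\<exists>y. y \<notin> U \<and> (\<forall>i\<in>Basis. \<bar>2 ^ fst p * (y \<bullet> i) - of_int (snd p i)\<bar> \<le> 3)"
      if "p \<in> G1 \<union> G2" for p
    proof (cases "p \<in> G1")
      case True
      then obtain y where y: "y \<in> cube p" "y \<notin> U" by (auto simp: G1_def)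
      have "\<bar>2 ^ fst p * (y \<bullet> i) - of_int (snd p i)\<bar> \<le> 3" if "i \<in> Basis" for i
        using mem_cubeD[OF y(1) that] by linarith
      with y(2) show ?thesis by blast
    next
      case False
      then have p: "p \<in> G2" using that by simp
      then obtain j x where x: "p = (j, cell j x)" "top j x" by (auto simp: G2_def)
      \<comment> \<open>A unit cube inside \<open>U\<close> would force total weight at least 1, so the maximal cube has a parent.\<close>
      have "j \<noteq> 0"
      proof
        assume "j = 0"
        then have "1 \<le> ?\<rho> (sub p)" using w_sub[OF p] x(1) by simp
        also have "\<dots> \<le> ?\<rho> C" using sub_C by (intro emeasure_mono) auto
        finally show False using small by simp
      qed
      then obtain k where k: "j = Suc k" using not0_implies_Suc by blast
      then have "\<not> cube (k, cell k x) \<subseteq> U" using x(2) unfolding top_def by blast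
      then obtain y where y: "y \<in> cube (k, cell k x)" "y \<notin> U" by blast
      have "\<bar>2 ^ fst p * (y \<bullet> i) - of_int (snd p i)\<bar> \<le> 3" if "i \<in> Basis" for i
        using mem_cubeD[OF y(1) that] mem_cubeD[OF mem_cube_cell[of x k] that]
          mem_cubeD[OF mem_cube_cell[of x j] that] x(1) k by (simp add: abs_le_iff)
      with y(2) show ?thesis by blast
    qed
    show "ennreal (\<Sum>p\<in>H. ?w p) \<le> 2 * ?\<rho> C" if H: "finite H" "H \<subseteq> G1 \<union> G2" for H
    proof -
      have "(\<Sum>p\<in>H. ?w p) \<le> (\<Sum>p\<in>H \<inter> G1. ?w p) + (\<Sum>p\<in>H \<inter> G2. ?w p)"
        using H by (subst sum.union_inter[symmetric]) (auto simp: Int_Un_distrib[symmetric] Int_absorb2 intro!: sum_nonneg)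
      then have "ennreal (\<Sum>p\<in>H. ?w p) \<le> ennreal (\<Sum>p\<in>H \<inter> G1. ?w p) + ennreal (\<Sum>p\<in>H \<inter> G2. ?w p)"
        by (subst ennreal_plus[symmetric]) (auto intro!: sum_nonneg ennreal_leI)
      also have "\<dots> \<le> ?\<rho> C + ?\<rho> C"
        using H by (intro add_mono sumG1 sumG2) auto
      finally show ?thesis by (simp add: mult_2)
    qed
  qed
qed

section \<open>Hausdorff content and the Choquet integral\<close>

lemma omega_pos: "0 < \<beta> \<Longrightarrow> 0 < omega \<beta>"
  by (simp add: omega_def Gamma_real_pos)

lemma ex_dyadic_scale:
  assumes "0 < (s::real)" "s \<le> 1"
  obtains k :: nat where "s \<le> 1 / 2 ^ k" "1 / 2 ^ k \<le> 2 * s"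
proof -
  obtain n where "1 / s < 2 ^ n" using real_arch_pow[of 2 "1 / s"] by auto
  then obtain n where n: "1 / s < 2 ^ n" "\<forall>m<n. \<not> 1 / s < 2 ^ m"
    using exists_least_iff[of "\<lambda>n. 1 / s < 2 ^ n"] by blast
  have "n \<noteq> 0" using n(1) assms by (intro notI) (simp add: field_simps)
  then obtain k where k: "n = Suc k" using not0_implies_Suc by blast
  show thesis
    by (rule that[of k]) (use n assms k in \<open>auto simp: field_simps not_less\<close>)
qed

text \<open>
  At a scale with side length between \<open>2r\<close> and \<open>4r\<close> the ball meets at most two cubes in each coordinate
  direction.
\<close>

lemma ball_subset_cubes:
  fixes c :: "'a::euclidean_space"
  assumes r: "0 < r" "r \<le> 1/2" and \<beta>: "0 < \<beta>"
  obtains D :: "(nat \<times> ('a \<Rightarrow> int)) set" where "finite D" "\<And>q. q \<in> D \<Longrightarrow> snd q \<in> (\<Pi>\<^sub>E i\<in>Basis. UNIV)"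
    "ball c r \<subseteq> (\<Union>q\<in>D. cube q)"
    "emeasure (cube_measure \<beta>) D \<le> ennreal (2 ^ DIM('a) * 4 powr \<beta> * r powr \<beta>)"
proof -
  obtain k where k: "2 * r \<le> 1 / 2 ^ k" "1 / 2 ^ k \<le> 2 * (2 * r)"
    using ex_dyadic_scale[of "2 * r"] r by auto
  define f where "f i = \<lfloor>2 ^ k * (c \<bullet> i - r)\<rfloor>" for i
  define N where "N = (\<Pi>\<^sub>E i\<in>(Basis::'a set). {f i..f i + 1})"
  have card: "card N = 2 ^ DIM('a)" unfolding N_def by (simp add: card_PiE)
  have fin: "finite N" unfolding N_def by (intro finite_PiE) auto
  show thesis
  proof (rule that[of "Pair k ` N"])
    show "finite (Pair k ` N)" using fin by simp
    show "snd q \<in> (\<Pi>\<^sub>E i\<in>Basis. UNIV)" if "q \<in> Pair k ` N" for q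
      using that by (auto simp: N_def PiE_def)
    show "ball c r \<subseteq> (\<Union>q\<in>Pair k ` N. cube q)"
    proof
      fix x assume x: "x \<in> ball c r"
      have "cell k x i \<in> {f i..f i + 1}" if i: "i \<in> Basis" for i
      proof -
        have "\<bar>(x - c) \<bullet> i\<bar> < r"
          using x Basis_le_norm[OF i, of "x - c"] by (simp add: dist_norm norm_minus_commute)
        then have lo: "c \<bullet> i - r \<le> x \<bullet> i" and hi: "x \<bullet> i \<le> c \<bullet> i - r + 2 * r"
          by (auto simp: inner_diff_left)
        have "2 ^ k * (c \<bullet> i - r) \<le> 2 ^ k * (x \<bullet> i)" using lo by simp
        moreover have "2 ^ k * (x \<bullet> i) \<le> 2 ^ k * (c \<bullet> i - r) + 1"
        proof -
          have "2 ^ k * (x \<bullet> i) \<le> 2 ^ k * (c \<bullet> i - r + 2 * r)" using hi by simp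
          moreover have "2 ^ k * (2 * r) \<le> 1" using k(1) by (simp add: field_simps)
          ultimately show ?thesis by (simp add: algebra_simps)
        qed
        ultimately show ?thesis
          using i by (auto simp: cell_def f_def intro: floor_mono) linarith
      qed
      then have "cell k x \<in> N" by (auto simp: N_def PiE_def cell_def)
      then show "x \<in> (\<Union>q\<in>Pair k ` N. cube q)" using mem_cube_cell by blast
    qed
    have "(1 / 2 ^ k) powr \<beta> \<le> (4 * r) powr \<beta>"
      using k \<beta> by (intro powr_mono2) auto
    also have "\<dots> = 4 powr \<beta> * r powr \<beta>" using r by (simp add: powr_mult)
    finally have "(\<Sum>p\<in>Pair k ` N. (1 / 2 ^ fst p) powr \<beta>) \<le> 2 ^ DIM('a) * (4 powr \<beta> * r powr \<beta>)"
      by (subst sum.reindex) (auto simp: inj_on_def card)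
    then show "emeasure (cube_measure \<beta>) (Pair k ` N) \<le> ennreal (2 ^ DIM('a) * 4 powr \<beta> * r powr \<beta>)"
      using fin by (subst emeasure_cube_measure_finite) (auto intro!: ennreal_leI simp: mult.assoc)
  qed
qed

definition cube_const :: "'a::euclidean_space itself \<Rightarrow> real \<Rightarrow> real" where
  "cube_const _ \<beta> = 2 ^ DIM('a) * 4 powr \<beta> / omega \<beta>"

lemma cube_const_pos: "0 < \<beta> \<Longrightarrow> 0 < cube_const TYPE('a::euclidean_space) \<beta>"
  by (simp add: cube_const_def omega_pos)

text \<open>
  Smallness of \<open>\<epsilon>\<close> forces all radii of a good cover to be at most \<open>1/2\<close>, so that nonnegative scales
  suffice.
\<close>

lemma content_imp_cube_cover:
  fixes E :: "'a::euclidean_space set"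
  assumes \<beta>: "0 < \<beta>" and \<epsilon>: "0 < \<epsilon>" "\<epsilon> \<le> omega \<beta> * (1/2) powr \<beta>"
    and E: "hausdorff_content \<beta> E < ennreal \<epsilon>"
  obtains C where "countable C" "\<And>q. q \<in> C \<Longrightarrow> snd q \<in> (\<Pi>\<^sub>E i\<in>Basis. UNIV)"
    "E \<subseteq> (\<Union>q\<in>C. cube q)"
    "emeasure (cube_measure \<beta>) C \<le> ennreal (cube_const TYPE('a) \<beta> * \<epsilon>)"
proof -
  let ?c = "cube_const TYPE('a) \<beta>"
  obtain x :: "nat \<Rightarrow> 'a" and r :: "nat \<Rightarrow> real" where r: "\<And>i. 0 \<le> r i"
    and cov: "E \<subseteq> (\<Union>i. ball (x i) (r i))"
    and sum: "(\<Sum>i. ennreal (omega \<beta> * r i powr \<beta>)) < ennreal \<epsilon>"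
    using E unfolding hausdorff_content_def by (auto simp: INF_less_iff)
  have small: "r i \<le> 1/2" for i
  proof (rule ccontr)
    assume "\<not> r i \<le> 1/2"
    then have "(1/2) powr \<beta> \<le> r i powr \<beta>" using \<beta> by (intro powr_mono2) auto
    then have "\<epsilon> \<le> omega \<beta> * r i powr \<beta>"
      using \<epsilon>(2) omega_pos[OF \<beta>] by (meson mult_left_mono order_trans less_imp_le)
    then have "ennreal \<epsilon> \<le> ennreal (omega \<beta> * r i powr \<beta>)" by (rule ennreal_leI)
    also have "\<dots> \<le> (\<Sum>i. ennreal (omega \<beta> * r i powr \<beta>))"
      using sum_le_suminf[of "\<lambda>i. ennreal (omega \<beta> * r i powr \<beta>)" "{i}"] by simp
    finally show False using sum by simp
  qed
  have "\<exists>D. finite D \<and> (\<forall>q\<in>D. snd q \<in> (\<Pi>\<^sub>E i\<in>Basis. UNIV)) \<and> ball (x i) (r i) \<subseteq> (\<Union>q\<in>D. cube q) \<and>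
      emeasure (cube_measure \<beta>) D \<le> ennreal ?c * ennreal (omega \<beta> * r i powr \<beta>)" for i
  proof (cases "r i = 0")
    case True
    then show ?thesis by (intro exI[of _ "{}"]) auto
  next
    case False
    then have "0 < r i" using r[of i] by simp
    obtain D
      where D: "finite D" "\<forall>q\<in>D. snd q \<in> (\<Pi>\<^sub>E i\<in>Basis. UNIV)" "ball (x i) (r i) \<subseteq> (\<Union>q\<in>D. cube q)"
        "emeasure (cube_measure \<beta>) D \<le> ennreal (2 ^ DIM('a) * 4 powr \<beta> * r i powr \<beta>)"
      by (rule ball_subset_cubes[OF \<open>0 < r i\<close> small \<beta>, of "x i"]) auto
    have "2 ^ DIM('a) * 4 powr \<beta> * r i powr \<beta> = ?c * (omega \<beta> * r i powr \<beta>)"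
      using omega_pos[OF \<beta>] by (simp add: cube_const_def)
    then have "ennreal (2 ^ DIM('a) * 4 powr \<beta> * r i powr \<beta>) = ennreal ?c * ennreal (omega \<beta> * r i powr \<beta>)"
      using cube_const_pos[OF \<beta>, where 'a='a]
      by (simp only: ennreal_mult'[OF less_imp_le])
    with D show ?thesis by auto
  qed
  then obtain D where D: "\<And>i. finite (D i)" "\<And>i q. q \<in> D i \<Longrightarrow> snd q \<in> (\<Pi>\<^sub>E i\<in>Basis. UNIV)"
    "\<And>i. ball (x i) (r i) \<subseteq> (\<Union>q\<in>D i. cube q)"
    "\<And>i. emeasure (cube_measure \<beta>) (D i) \<le> ennreal ?c * ennreal (omega \<beta> * r i powr \<beta>)"
    by metis
  show thesis
  proof (rule that[of "\<Union>i. D i"])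
    show "countable (\<Union>i. D i)" using D(1) by (auto intro: countable_finite)
    show "snd q \<in> (\<Pi>\<^sub>E i\<in>Basis. UNIV)" if "q \<in> (\<Union>i. D i)" for q using that D(2) by blast
    show "E \<subseteq> (\<Union>q\<in>\<Union>i. D i. cube q)"
      using order_trans[OF cov UN_mono[OF order_refl D(3)]] by (simp only: UN_UN_flatten)
    have "emeasure (cube_measure \<beta>) (\<Union>i. D i) \<le> (\<Sum>i. emeasure (cube_measure \<beta>) (D i))"
      by (rule emeasure_subadditive_countably) auto
    also have "\<dots> \<le> (\<Sum>i. ennreal ?c * ennreal (omega \<beta> * r i powr \<beta>))"
      by (intro suminf_le D(4)) auto
    also have "\<dots> = ennreal ?c * (\<Sum>i. ennreal (omega \<beta> * r i powr \<beta>))"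
      by simp
    also have "\<dots> \<le> ennreal ?c * ennreal \<epsilon>"
      using sum by (intro mult_left_mono) auto
    also have "\<dots> = ennreal (?c * \<epsilon>)"
      using cube_const_pos[OF \<beta>, where 'a='a] \<epsilon>(1) by (simp add: ennreal_mult')
    finally show "emeasure (cube_measure \<beta>) (\<Union>i. D i) \<le> ennreal (?c * \<epsilon>)" .
  qed
qed

text \<open>
  A covering set becomes a ball whose radius is its diameter plus a positive amount \<open>s i\<close> with summable
  powers; the extra amount is needed because sets of diameter zero cost nothing in the Hausdorff measure,
  while balls of radius zero are empty.
\<close>

lemma content_eq_0_if_hausdorff_measure_eq_0:
  fixes E :: "'a::euclidean_space set"
  assumes \<beta>: "0 < \<beta>" and E: "hausdorff_measure \<beta> E = 0"
  shows "hausdorff_content \<beta> E = 0"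
proof -
  have "hausdorff_content \<beta> E \<le> ennreal \<epsilon>" if \<epsilon>: "0 < \<epsilon>" for \<epsilon>
  proof -
    define \<eta> where "\<eta> = \<epsilon> / (4 powr \<beta> + omega \<beta> * 2 powr \<beta>)"
    have pos: "0 < 4 powr \<beta> + omega \<beta> * 2 powr \<beta>"
      using omega_pos[OF \<beta>] by (simp add: add_pos_pos)
    then have \<eta>: "0 < \<eta>" using \<epsilon> by (simp add: \<eta>_def)
    let ?cov = "{C :: nat \<Rightarrow> 'a set. (\<forall>i. bounded (C i) \<and> diameter (C i) \<le> 1) \<and> E \<subseteq> (\<Union>i. C i)}"
    have "(INF C \<in> ?cov. \<Sum>i. ennreal (omega \<beta> * (diameter (C i) / 2) powr \<beta>)) \<le> hausdorff_measure \<beta> E"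
      unfolding hausdorff_measure_def by (rule SUP_upper) simp
    then have "(INF C \<in> ?cov. \<Sum>i. ennreal (omega \<beta> * (diameter (C i) / 2) powr \<beta>)) < ennreal \<eta>"
      using E \<eta> by simp
    then obtain C :: "nat \<Rightarrow> 'a set" where C: "\<And>i. bounded (C i)" "E \<subseteq> (\<Union>i. C i)"
      and sum: "(\<Sum>i. ennreal (omega \<beta> * (diameter (C i) / 2) powr \<beta>)) < ennreal \<eta>"
      by (auto simp: INF_less_iff)
    define s where "s i = (\<eta> * (1/2) ^ Suc i) powr (1 / \<beta>)" for i
    define r where "r i = diameter (C i) + s i" for i
    define x where "x i = (SOME y. y \<in> C i)" for i
    have s: "0 < s i" "s i powr \<beta> = \<eta> * (1/2) ^ Suc i" for i
      using \<eta> \<beta> by (simp_all add: s_def powr_powr)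
    have d: "0 \<le> diameter (C i)" for i using C(1) diameter_ge_0 by blast
    have sub: "C i \<subseteq> ball (x i) (r i)" for i
    proof
      fix y assume y: "y \<in> C i"
      then have "x i \<in> C i" unfolding x_def by (rule someI)
      then have "dist (x i) y \<le> diameter (C i)" using diameter_bounded_bound[OF C(1)] y by blast
      then show "y \<in> ball (x i) (r i)" using s(1)[of i] by (simp add: r_def)
    qed
    have le: "omega \<beta> * r i powr \<beta> \<le> 4 powr \<beta> * (omega \<beta> * (diameter (C i) / 2) powr \<beta>) +
        omega \<beta> * 2 powr \<beta> * \<eta> * (1/2) ^ Suc i" for i
    proof -
      let ?D = "diameter (C i)"
      have "r i powr \<beta> \<le> (2 * max ?D (s i)) powr \<beta>"
        using d[of i] s(1)[of i] \<beta> by (intro powr_mono2) (auto simp: r_def)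
      also have "\<dots> = max ((2 * ?D) powr \<beta>) ((2 * s i) powr \<beta>)"
      proof (cases "?D \<le> s i")
        case True
        then have "(2 * ?D) powr \<beta> \<le> (2 * s i) powr \<beta>"
          using d[of i] \<beta> by (intro powr_mono2) auto
        with True show ?thesis by (simp add: max_def)
      next
        case False
        then have "(2 * s i) powr \<beta> \<le> (2 * ?D) powr \<beta>"
          using s(1)[of i] \<beta> by (intro powr_mono2) auto
        with False show ?thesis by (simp add: max_def)
      qed
      also have "\<dots> \<le> (2 * ?D) powr \<beta> + (2 * s i) powr \<beta>" by (simp add: max_def)
      also have "(2 * ?D) powr \<beta> = 4 powr \<beta> * (?D / 2) powr \<beta>"
        using d[of i] by (simp flip: powr_mult)
      also have "(2 * s i) powr \<beta> = 2 powr \<beta> * (\<eta> * (1/2) ^ Suc i)"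
        using s[of i] by (simp add: powr_mult)
      finally have "omega \<beta> * r i powr \<beta> \<le> omega \<beta> * (4 powr \<beta> * (?D / 2) powr \<beta> + 2 powr \<beta> * (\<eta> * (1/2) ^ Suc i))"
        using omega_pos[OF \<beta>] by (intro mult_left_mono) auto
      then show ?thesis by (simp add: algebra_simps)
    qed
    have "hausdorff_content \<beta> E \<le> (\<Sum>i. ennreal (omega \<beta> * r i powr \<beta>))"
      unfolding hausdorff_content_def
    proof (rule INF_lower2[of "(x, r)"])
      have "0 \<le> r i" for i using d[of i] s(1)[of i] by (simp add: r_def)
      moreover have "E \<subseteq> (\<Union>i. ball (x i) (r i))" using C(2) sub by blast
      ultimately show "(x, r) \<in> {(x, r). (\<forall>i. 0 \<le> r i) \<and> E \<subseteq> (\<Union>i. ball (x i) (r i))}" by simp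
    qed simp
    also have "\<dots> \<le> (\<Sum>i. ennreal (4 powr \<beta>) * ennreal (omega \<beta> * (diameter (C i) / 2) powr \<beta>) +
        ennreal (omega \<beta> * 2 powr \<beta> * \<eta> * (1/2) ^ Suc i))"
    proof (rule suminf_le)
      show "ennreal (omega \<beta> * r i powr \<beta>) \<le> ennreal (4 powr \<beta>) * ennreal (omega \<beta> * (diameter (C i) / 2) powr \<beta>) +
        ennreal (omega \<beta> * 2 powr \<beta> * \<eta> * (1/2) ^ Suc i)" for i
        using ennreal_leI[OF le[of i]] omega_pos[OF \<beta>] \<eta>
        by (subst (asm) ennreal_plus) (auto simp: ennreal_mult')
    qed auto
    also have "\<dots> = ennreal (4 powr \<beta>) * (\<Sum>i. ennreal (omega \<beta> * (diameter (C i) / 2) powr \<beta>)) +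
        (\<Sum>i. ennreal (omega \<beta> * 2 powr \<beta> * \<eta> * (1/2) ^ Suc i))"
      by (subst suminf_add[symmetric]) auto
    also have "(\<Sum>i. ennreal (omega \<beta> * 2 powr \<beta> * \<eta> * (1/2) ^ Suc i)) = ennreal (omega \<beta> * 2 powr \<beta> * \<eta>)"
      using sums_mult[OF power_half_series, of "omega \<beta> * 2 powr \<beta> * \<eta>"] omega_pos[OF \<beta>] \<eta>
      by (intro suminf_ennreal_eq) auto
    also have "ennreal (4 powr \<beta>) * (\<Sum>i. ennreal (omega \<beta> * (diameter (C i) / 2) powr \<beta>)) + ennreal (omega \<beta> * 2 powr \<beta> * \<eta>)
        \<le> ennreal (4 powr \<beta>) * ennreal \<eta> + ennreal (omega \<beta> * 2 powr \<beta> * \<eta>)"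
      using sum by (intro add_right_mono mult_left_mono) auto
    also have "\<dots> = ennreal ((4 powr \<beta> + omega \<beta> * 2 powr \<beta>) * \<eta>)"
      using \<eta> omega_pos[OF \<beta>] by (simp add: distrib_right ennreal_mult)
    also have "\<dots> = ennreal \<epsilon>" using pos by (simp add: \<eta>_def)
    finally show ?thesis .
  qed
  note le = this
  have "hausdorff_content \<beta> E \<le> 0"
  proof (rule ennreal_le_epsilon)
    show "hausdorff_content \<beta> E \<le> 0 + ennreal e" if "0 < e" for e
      using le[OF that] by simp
  qed
  then show ?thesis by simp
qed

text \<open>
  If the content of the superlevel sets were at least \<open>\<epsilon> / t\<close> for all \<open>t \<ge> 1\<close>, the Choquet integral would be
  at least \<open>\<epsilon> ln T\<close> for all \<open>T\<close>.
\<close>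

lemma choquet_integral_tail:
  fixes f :: "'a::euclidean_space \<Rightarrow> ereal"
  assumes fin: "choquet_integral \<beta> f < \<infinity>" and \<epsilon>: "0 < \<epsilon>"
  obtains t :: real where "1 \<le> t" "hausdorff_content \<beta> {x. ereal t < \<bar>f x\<bar>} < ennreal (\<epsilon> / t)"
proof (rule ccontr)
  note select = that
  assume "\<not> thesis"
  have ge: "ennreal (\<epsilon> / t) \<le> hausdorff_content \<beta> {x. ereal t < \<bar>f x\<bar>}" if "1 \<le> t" for t
    using select[OF that] \<open>\<not> thesis\<close> not_less by blast
  have "ennreal (\<epsilon> * ln T) \<le> choquet_integral \<beta> f" if T: "1 \<le> T" for T
  proof -
    have "(\<integral>\<^sup>+t. ennreal (\<epsilon> / t) * indicator {1..T} t \<partial>lborel) = ennreal (\<epsilon> * ln T - \<epsilon> * ln 1)"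
      using T \<epsilon> by (intro nn_integral_FTC_Icc) (auto intro!: derivative_eq_intros)
    moreover have "(\<integral>\<^sup>+t. ennreal (\<epsilon> / t) * indicator {1..T} t \<partial>lborel) \<le> choquet_integral \<beta> f"
      unfolding choquet_integral_def by (rule nn_integral_mono) (auto simp: indicator_def ge)
    ultimately show ?thesis by simp
  qed
  note le = this
  obtain b where b: "0 \<le> b" "choquet_integral \<beta> f = ennreal b"
    using fin by (cases "choquet_integral \<beta> f") auto
  have "ennreal (\<epsilon> * ln (exp ((b + 1) / \<epsilon>))) \<le> ennreal b"
    using le[of "exp ((b + 1) / \<epsilon>)"] b \<epsilon> by simp
  then have "b + 1 \<le> b" using b \<epsilon> by (simp add: ennreal_le_iff)
  then show False by simp
qed

section \<open>Smooth cutoffs and the dimension bound\<close>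

lemma norm_le_coordinates:
  fixes x :: "'a::euclidean_space"
  assumes "\<And>i. i \<in> Basis \<Longrightarrow> \<bar>2 ^ k * (x \<bullet> i)\<bar> \<le> c"
  shows "norm x \<le> real DIM('a) * c * (1 / 2 ^ k)"
proof -
  have "norm x \<le> (\<Sum>i\<in>Basis. \<bar>x \<bullet> i\<bar>)" by (rule norm_le_l1)
  also have "\<dots> \<le> (\<Sum>i\<in>(Basis::'a set). c * (1 / 2 ^ k))"
    by (rule sum_mono) (use assms in \<open>simp add: abs_mult field_simps\<close>)
  finally show ?thesis by simp
qed

text \<open>
  The bumps that are summed to cover the cube with index \<open>n\<close> and its halo.
\<close>

definition near :: "('a::euclidean_space \<Rightarrow> int) \<Rightarrow> ('a \<Rightarrow> int) set" where
  "near n = (\<Pi>\<^sub>E i\<in>Basis. {n i - 1..n i + 2})"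

lemma finite_near: "finite (near n)"
  unfolding near_def by (intro finite_PiE) auto

lemma card_near: "card (near (n :: 'a::euclidean_space \<Rightarrow> int)) = 4 ^ DIM('a)"
  unfolding near_def by (simp add: card_PiE)

text \<open>
  An open neighbourhood of the cube, on which the bumps in \<open>near\<close> still sum to 1.  Compactness of \<open>K\<close> calls
  for open sets.
\<close>

definition halo :: "nat \<times> ('a::euclidean_space \<Rightarrow> int) \<Rightarrow> 'a set" where
  "halo p = {x. \<forall>i\<in>Basis. of_int (snd p i) - 1 < 2 ^ fst p * (x \<bullet> i) \<and>
     2 ^ fst p * (x \<bullet> i) < of_int (snd p i) + 2}"

lemma open_halo: "open (halo p)"
proof -
  have "halo p = (\<Inter>i\<in>Basis. {x. of_int (snd p i) - 1 < 2 ^ fst p * (x \<bullet> i)} \<inter>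
     {x. 2 ^ fst p * (x \<bullet> i) < of_int (snd p i) + 2})" by (auto simp: halo_def)
  also have "open \<dots>"
    by (intro open_INT open_Int open_Collect_less continuous_intros ballI) auto
  finally show ?thesis .
qed

lemma cube_subset_halo: "cube p \<subseteq> halo p"
proof
  fix x assume x: "x \<in> cube p"
  show "x \<in> halo p"
    unfolding halo_def using mem_cubeD[OF x] by (simp add: less_eq_real_def) (smt (verit))
qed

context lattice_partition begin

definition cutoff_const :: "(nat \<times> nat) set \<Rightarrow> real" where
  "cutoff_const F = 4 ^ DIM('a) * seminorm_bound F piece_bound (real DIM('a) * 6)"

lemma cutoff_const_pos: "0 < cutoff_const F"
  unfolding cutoff_const_def
  using seminorm_bound_ge_1[of piece_bound "real DIM('a) * 6" F] piece_bound_nonneg by simp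

text \<open>
  The cutoff is \<open>1 - remainder\<close>, where the bumps at scale \<open>2\<^sup>-\<^sup>k\<close> are those near the chosen cubes of that scale.
  Each piece is supported within six side lengths (per coordinate) of a point where the maximal function
  is at most \<open>t\<close>, and each cube of \<open>H\<close> is responsible for at most \<open>4\<^sup>d\<close> pieces.
\<close>

lemma exists_cutoff:
  fixes \<mu> :: "'a set \<Rightarrow> real"
  assumes \<mu>: "signed_measure \<mu>" and F: "finite F" and t: "0 \<le> t" and H: "finite H"
    and cover: "K \<subseteq> (\<Union>p\<in>H. halo p)"
    and meet: "\<And>p. p \<in> H \<Longrightarrow> cube p \<inter> K \<noteq> {}"
    and good: "\<And>p. p \<in> H \<Longrightarrow> \<exists>y. grand_maximal F (real DIM('a) - \<beta>) (distribution_of \<mu>) y \<le> ereal t \<and>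
          (\<forall>i\<in>Basis. \<bar>2 ^ fst p * (y \<bullet> i) - of_int (snd p i)\<bar> \<le> 3)"
  obtains u where "continuous_on UNIV u" "\<And>x. 0 \<le> u x" "\<And>x. u x \<le> 1" "\<And>x. x \<in> K \<Longrightarrow> u x = 1"
    "\<And>x. u x \<noteq> 0 \<Longrightarrow> \<exists>p\<in>H. \<exists>z\<in>K. dist z x \<le> real DIM('a) * 3 * (1 / 2 ^ fst p)"
    "norm (signed_integral \<mu> (\<lambda>x. complex_of_real (u x)))
       \<le> cutoff_const F * t * (\<Sum>p\<in>H. (1 / 2 ^ fst p) powr \<beta>)"
proof -
  define R where "R = real DIM('a) * 6"
  have R: "0 \<le> R" by (simp add: R_def)
  define A where "A = seminorm_bound F piece_bound R"
  have A: "1 \<le> A" unfolding A_def by (rule seminorm_bound_ge_1[OF piece_bound_nonneg R])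
  define S where "S k = (\<Union>p\<in>{p\<in>H. fst p = k}. near (snd p))" for k
  \<comment> \<open>any bound for the scales that occur in \<open>H\<close>\<close>
  define N where "N = Suc (\<Sum>p\<in>H. fst p)"
  have N: "fst p < N" if "p \<in> H" for p
    using member_le_sum[OF that, of fst] H by (simp add: N_def)
  have Sfin: "finite (S k)" for k using H finite_near by (auto simp: S_def)
  have Sidx: "S k \<subseteq> indices" for k by (auto simp: S_def near_def PiE_def)
  note S = Sfin Sidx
  have in_S: "\<exists>p\<in>H. fst p = k \<and> m \<in> near (snd p)" if "m \<in> S k" for m k
    using that by (force simp: S_def)
  define u where "u x = 1 - remainder S N x" for x
  define piece where "piece q x = atom (fst q) (snd q) x * remainder S (fst q) x" for q x
  let ?I = "Sigma {..<N} S"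
  have fin_I: "finite ?I" using Sfin by auto
  have u_sum: "u x = (\<Sum>q\<in>?I. piece q x)" for x
    unfolding u_def one_minus_remainder piece_def
    by (subst sum.Sigma) (use Sfin in \<open>auto simp: case_prod_unfold\<close>)
  have dpiece: "derivs_le M (\<lambda>m x. piece_bound m * (2 ^ fst q) ^ m *
      indicator sup_unit_ball (2 ^ fst q *\<^sub>R x - lattice (snd q))) (piece q)" for M q
    unfolding piece_def by (rule derivs_le_piece[OF S])
  have cont_piece: "continuous_on UNIV (piece q)" for q
    by (intro continuous_at_imp_continuous_on ballI differentiable_imp_continuous_within
        derivs_le_differentiable[OF dpiece])
  have piece_le: "\<bar>piece q x\<bar> \<le> piece_bound 0" for q x
    using derivs_le_bound[OF dpiece[of 0 q], of x] piece_bound_nonneg[of 0]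
    by (cases "2 ^ fst q *\<^sub>R x - lattice (snd q) \<in> sup_unit_ball") auto
  have "continuous_on UNIV u"
    unfolding u_sum[abs_def] by (intro continuous_on_sum cont_piece)
  moreover have "0 \<le> u x" "u x \<le> 1" for x
    using remainder_bounds[OF S] by (simp_all add: u_def)
  moreover have "u x = 1" if "x \<in> K" for x
  proof -
    obtain p where p: "p \<in> H" "\<And>i. i \<in> Basis \<Longrightarrow> of_int (snd p i) - 1 < 2 ^ fst p * (x \<bullet> i) \<and>
       2 ^ fst p * (x \<bullet> i) < of_int (snd p i) + 2"
      using cover \<open>x \<in> K\<close> by (auto simp: halo_def)
    have "1 \<le> layer (S (fst p)) (fst p) x"
      by (rule layer_ge_1[OF Sfin, of "snd p"]) (use p in \<open>auto simp: S_def near_def less_imp_le\<close>)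
    with layer_le_1[OF S] have "layer (S (fst p)) (fst p) x = 1" by (intro antisym)
    then have "remainder S N x = 0"
      unfolding remainder_def using N[OF p(1)] by (intro prod_zero) auto
    then show ?thesis by (simp add: u_def)
  qed
  moreover have "\<exists>p\<in>H. \<exists>z\<in>K. dist z x \<le> real DIM('a) * 3 * (1 / 2 ^ fst p)" if "u x \<noteq> 0" for x
  proof -
    obtain q where q: "q \<in> ?I" "piece q x \<noteq> 0"
      using \<open>u x \<noteq> 0\<close> unfolding u_sum by (rule sum.not_neutral_contains_not_neutral)
    have x: "2 ^ fst q *\<^sub>R x - lattice (snd q) \<in> sup_unit_ball"
      using q(2) atom_eq_0[of "fst q" x "snd q"] by (auto simp: piece_def)
    obtain p where p: "p \<in> H" "fst p = fst q" "snd q \<in> near (snd p)"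
      using in_S[of "snd q" "fst q"] q(1) by auto
    obtain z where z: "z \<in> cube p" "z \<in> K" using meet[OF p(1)] by blast
    have "\<bar>2 ^ fst p * ((z - x) \<bullet> i)\<bar> \<le> 3" if i: "i \<in> Basis" for i
    proof -
      have "\<bar>2 ^ fst p * (x \<bullet> i) - of_int (snd q i)\<bar> < 1"
        using x i p(2) by (simp add: sup_unit_ball_def inner_diff_left)
      moreover have "snd p i - 1 \<le> snd q i" "snd q i \<le> snd p i + 2"
        using p(3) i by (auto simp: near_def PiE_def Pi_def)
      then have "of_int (snd p i) - 1 \<le> real_of_int (snd q i)"
        "real_of_int (snd q i) \<le> of_int (snd p i) + 2" by linarith+
      ultimately show ?thesis
        using mem_cubeD[OF z(1) i] by (simp add: inner_diff_left right_diff_distrib abs_le_iff abs_less_iff)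
    qed
    from norm_le_coordinates[OF this] p(1) z(2) show ?thesis by (auto simp: dist_norm)
  qed
  moreover have "norm (signed_integral \<mu> (\<lambda>x. complex_of_real (u x)))
      \<le> cutoff_const F * t * (\<Sum>p\<in>H. (1 / 2 ^ fst p) powr \<beta>)"
  proof -
    have each: "norm (signed_integral \<mu> (\<lambda>x. complex_of_real (piece q x))) \<le> A * t * (1 / 2 ^ fst q) powr \<beta>"
      if q: "q \<in> ?I" for q
    proof -
      obtain p where p: "p \<in> H" "fst p = fst q" "snd q \<in> near (snd p)"
        using in_S[of "snd q" "fst q"] q by auto
      obtain y where y: "grand_maximal F (real DIM('a) - \<beta>) (distribution_of \<mu>) y \<le> ereal t"
        "\<And>i. i \<in> Basis \<Longrightarrow> \<bar>2 ^ fst p * (y \<bullet> i) - of_int (snd p i)\<bar> \<le> 3"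
        using good[OF p(1)] by blast
      let ?s = "1 / 2 ^ fst q :: real"
      have sub: "x \<in> cball y (R * ?s)" if x: "2 ^ fst q *\<^sub>R x - lattice (snd q) \<in> sup_unit_ball" for x
      proof -
        have "\<bar>2 ^ fst p * ((y - x) \<bullet> i)\<bar> \<le> 6" if i: "i \<in> Basis" for i
        proof -
          have "\<bar>2 ^ fst p * (x \<bullet> i) - of_int (snd q i)\<bar> < 1"
            using x i p(2) by (simp add: sup_unit_ball_def inner_diff_left)
          moreover have "snd p i - 1 \<le> snd q i" "snd q i \<le> snd p i + 2"
            using p(3) i by (auto simp: near_def PiE_def Pi_def)
          then have "of_int (snd p i) - 1 \<le> real_of_int (snd q i)"
            "real_of_int (snd q i) \<le> of_int (snd p i) + 2" by linarith+
          ultimately show ?thesis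
            using y(2)[OF i] by (simp add: inner_diff_left right_diff_distrib abs_le_iff abs_less_iff)
        qed
        from norm_le_coordinates[OF this] p(2) show ?thesis by (simp add: dist_norm R_def)
      qed
      have "norm (signed_integral \<mu> (\<lambda>x. complex_of_real (piece q x)))
          \<le> A * t * ?s powr (real DIM('a) - (real DIM('a) - \<beta>))"
      unfolding A_def
      proof (rule grand_maximal_controls_localized[OF F piece_bound_nonneg R _ _ y(1)])
        show "derivs_le M (\<lambda>m x. piece_bound m * inverse ?s ^ m * indicator (cball y (R * ?s)) x) (piece q)" for M
        proof (rule derivs_le_mono[OF dpiece])
          fix m and x :: 'a
          show "piece_bound m * (2 ^ fst q) ^ m * indicator sup_unit_ball (2 ^ fst q *\<^sub>R x - lattice (snd q))
              \<le> piece_bound m * inverse ?s ^ m * indicator (cball y (R * ?s)) x"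
            using sub[of x] piece_bound_nonneg[of m]
            by (intro mult_mono) (auto simp: indicator_def)
        qed
      qed simp
      then show ?thesis by simp
    qed
    have "signed_integral \<mu> (\<lambda>x. complex_of_real (u x)) =
        (\<Sum>q\<in>?I. signed_integral \<mu> (\<lambda>x. complex_of_real (piece q x)))"
      unfolding u_sum of_real_sum
      by (rule signed_integral_sum[OF \<mu> fin_I, where c="\<lambda>_. piece_bound 0"])
         (use piece_le in \<open>auto intro: continuous_on_of_real cont_piece\<close>)
    then have "norm (signed_integral \<mu> (\<lambda>x. complex_of_real (u x))) \<le> (\<Sum>q\<in>?I. A * t * (1 / 2 ^ fst q) powr \<beta>)"
      by (simp only:) (rule sum_norm_le, rule each)
    also have "\<dots> \<le> (\<Sum>q\<in>(\<lambda>(p, m). (fst p, m)) ` Sigma H (\<lambda>p. near (snd p)). A * t * (1 / 2 ^ fst q) powr \<beta>)"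
    proof (rule sum_mono2)
      show "?I \<subseteq> (\<lambda>(p, m). (fst p, m)) ` Sigma H (\<lambda>p. near (snd p))"
      proof
        fix q assume "q \<in> ?I"
        then obtain p where "p \<in> H" "fst p = fst q" "snd q \<in> near (snd p)"
          using in_S[of "snd q" "fst q"] by auto
        then show "q \<in> (\<lambda>(p, m). (fst p, m)) ` Sigma H (\<lambda>p. near (snd p))"
          by (intro image_eqI[of _ _ "(p, snd q)"]) auto
      qed
    qed (use H finite_near A t in \<open>auto intro!: finite_imageI finite_SigmaI\<close>)
    also have "\<dots> \<le> (\<Sum>q\<in>Sigma H (\<lambda>p. near (snd p)). A * t * (1 / 2 ^ fst (fst q)) powr \<beta>)"
      using sum_image_le[of "Sigma H (\<lambda>p. near (snd p))" "\<lambda>q. A * t * (1 / 2 ^ fst q) powr \<beta>" "\<lambda>(p, m). (fst p, m)"]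
        H A t by (simp add: case_prod_unfold comp_def finite_SigmaI finite_near)
    also have "\<dots> = (\<Sum>p\<in>H. \<Sum>m\<in>near (snd p). A * t * (1 / 2 ^ fst p) powr \<beta>)"
      by (subst sum.Sigma) (use H finite_near in \<open>auto simp: case_prod_unfold\<close>)
    also have "\<dots> = cutoff_const F * t * (\<Sum>p\<in>H. (1 / 2 ^ fst p) powr \<beta>)"
      by (simp add: cutoff_const_def A_def R_def card_near sum_distrib_left sum_distrib_right mult_ac)
    finally show ?thesis .
  qed
  ultimately show thesis by (rule that)
qed

end

text \<open>
  For every \<open>\<delta>\<close> there is a cutoff of \<open>K\<close>, supported within \<open>\<delta>\<close> of \<open>K\<close>, with integral at most \<open>\<delta>\<close>; dominated
  convergence then gives \<open>\<mu> K = 0\<close>.  The side lengths are small automatically, because a single cube cannot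
  weigh more than all of them together.
\<close>

lemma compact_content_eq_0_imp_measure_eq_0:
  fixes \<mu> :: "'a::euclidean_space set \<Rightarrow> real"
  assumes \<beta>: "0 < \<beta>" "\<beta> \<le> real DIM('a)" and \<mu>: "signed_measure \<mu>" and F: "finite F"
    and M: "choquet_integral \<beta> (grand_maximal F (real DIM('a) - \<beta>) (distribution_of \<mu>)) < \<infinity>"
    and K: "compact K" "hausdorff_content \<beta> K = 0"
  shows "\<mu> K = 0"
proof -
  let ?M = "grand_maximal F (real DIM('a) - \<beta>) (distribution_of \<mu>)"
  let ?d = "real DIM('a)" and ?c = "cube_const TYPE('a) \<beta>"
  obtain \<phi> :: "'a \<Rightarrow> real" and B where "lattice_partition \<phi> B" by (rule exists_lattice_partition)
  then interpret lattice_partition \<phi> B .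
  define A where "A = cutoff_const F"
  have A: "0 < A" unfolding A_def by (rule cutoff_const_pos)
  have c: "0 < ?c" by (rule cube_const_pos[OF \<beta>(1)])
  have approx: "\<exists>u. continuous_on UNIV u \<and> (\<forall>x. 0 \<le> u x \<and> u x \<le> 1) \<and> (\<forall>x\<in>K. u x = 1) \<and>
      (\<forall>x. u x \<noteq> 0 \<longrightarrow> (\<exists>z\<in>K. dist z x \<le> \<delta>)) \<and>
      norm (signed_integral \<mu> (\<lambda>x. complex_of_real (u x))) \<le> \<delta>" if \<delta>: "0 < \<delta>" for \<delta>
  proof -
    \<comment> \<open>The four bounds on \<open>\<epsilon>\<close> serve, in this order: radii at most \<open>1/2\<close> in the ball covers, total weight below
      1, the bound for the integral, and the bound for the side lengths.\<close>
    define \<epsilon> where "\<epsilon> = Min {omega \<beta> * (1/2) powr \<beta>, 1 / (4 * ?c), \<delta> / (4 * A * ?c), (\<delta> / (3 * ?d)) powr \<beta> / (4 * ?c)}"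
    have \<epsilon>0: "0 < \<epsilon>" using c A \<delta> omega_pos[OF \<beta>(1)] by (simp add: \<epsilon>_def)
    have \<epsilon>1: "\<epsilon> \<le> omega \<beta> * (1/2) powr \<beta>" and \<epsilon>2: "\<epsilon> \<le> 1 / (4 * ?c)"
      and \<epsilon>3: "\<epsilon> \<le> \<delta> / (4 * A * ?c)" and \<epsilon>4: "\<epsilon> \<le> (\<delta> / (3 * ?d)) powr \<beta> / (4 * ?c)"
      by (simp_all add: \<epsilon>_def)
    obtain t where t: "1 \<le> t" and cont: "hausdorff_content \<beta> {x. ereal t < \<bar>?M x\<bar>} < ennreal (\<epsilon> / t)"
      by (rule choquet_integral_tail[OF M \<epsilon>0])
    define U where "U = {x. ereal t < \<bar>?M x\<bar>}"
    have et: "0 < \<epsilon> / t" "\<epsilon> / t \<le> \<epsilon>" using \<epsilon>0 t by (auto simp: field_simps)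
    have et1: "\<epsilon> / t \<le> omega \<beta> * (1/2) powr \<beta>" using et \<epsilon>1 by linarith
    obtain C1 where C1: "countable C1" "\<And>q. q \<in> C1 \<Longrightarrow> snd q \<in> (\<Pi>\<^sub>E i\<in>(Basis::'a set). UNIV)"
      "U \<subseteq> (\<Union>q\<in>C1. cube q)" "emeasure (cube_measure \<beta>) C1 \<le> ennreal (?c * (\<epsilon> / t))"
      by (rule content_imp_cube_cover[OF \<beta>(1) et(1) et1 cont, folded U_def]) (rule that)
    have cK: "hausdorff_content \<beta> K < ennreal (\<epsilon> / t)" using K(2) et by simp
    obtain C2 where C2: "countable C2" "\<And>q. q \<in> C2 \<Longrightarrow> snd q \<in> (\<Pi>\<^sub>E i\<in>(Basis::'a set). UNIV)"
      "K \<subseteq> (\<Union>q\<in>C2. cube q)" "emeasure (cube_measure \<beta>) C2 \<le> ennreal (?c * (\<epsilon> / t))"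
      by (rule content_imp_cube_cover[OF \<beta>(1) et(1) et1 cK]) (rule that)
    let ?C = "C1 \<union> C2"
    have mass: "emeasure (cube_measure \<beta>) ?C \<le> ennreal (2 * ?c * (\<epsilon> / t))"
    proof -
      have "emeasure (cube_measure \<beta>) ?C \<le> emeasure (cube_measure \<beta>) C1 + emeasure (cube_measure \<beta>) C2"
        by (rule emeasure_subadditive) auto
      also have "\<dots> \<le> ennreal (?c * (\<epsilon> / t)) + ennreal (?c * (\<epsilon> / t))"
        by (intro add_mono C1(4) C2(4))
      also have "\<dots> = ennreal (?c * (\<epsilon> / t) + ?c * (\<epsilon> / t))"
        by (intro ennreal_plus[symmetric] less_imp_le[OF mult_pos_pos] c et)
      also have "?c * (\<epsilon> / t) + ?c * (\<epsilon> / t) = 2 * ?c * (\<epsilon> / t)" by simp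
      finally show ?thesis .
    qed
    have half: "2 * ?c * (\<epsilon> / t) < 1"
    proof -
      have "2 * ?c * (\<epsilon> / t) \<le> 2 * ?c * (1 / (4 * ?c))"
        using et(2) \<epsilon>2 c by (intro mult_left_mono) auto
      also have "\<dots> < 1" using c by simp
      finally show ?thesis .
    qed
    have small: "emeasure (cube_measure \<beta>) ?C < 1"
      using mass half by (metis ennreal_1 ennreal_lessI le_less_trans zero_less_one)
    obtain G where G: "\<And>p. p \<in> G \<Longrightarrow> snd p \<in> (\<Pi>\<^sub>E i\<in>(Basis::'a set). UNIV)"
      "K \<subseteq> (\<Union>p\<in>G. cube p)" "\<And>p. p \<in> G \<Longrightarrow> cube p \<inter> K \<noteq> {}"
      "\<And>p. p \<in> G \<Longrightarrow> \<exists>y. y \<notin> U \<and> (\<forall>i\<in>Basis. \<bar>2 ^ fst p * (y \<bullet> i) - of_int (snd p i)\<bar> \<le> 3)"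
      and G_sum: "\<And>H. finite H \<Longrightarrow> H \<subseteq> G \<Longrightarrow>
        ennreal (\<Sum>p\<in>H. (1 / 2 ^ fst p) powr \<beta>) \<le> 2 * emeasure (cube_measure \<beta>) ?C"
    proof (rule stopping_cubes[OF \<beta> _ _ _ _ small, of K U])
      show "countable ?C" using C1(1) C2(1) by simp
      show "snd q \<in> (\<Pi>\<^sub>E i\<in>Basis. UNIV)" if "q \<in> ?C" for q using that C1(2) C2(2) by blast
      show "K \<subseteq> (\<Union>q\<in>?C. cube q)" "U \<subseteq> (\<Union>q\<in>?C. cube q)" using C1(3) C2(3) by blast+
    qed (rule that)
    have sum_le: "(\<Sum>p\<in>H. (1 / 2 ^ fst p) powr \<beta>) \<le> 4 * ?c * (\<epsilon> / t)" if "finite H" "H \<subseteq> G" for H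
    proof -
      have "ennreal (\<Sum>p\<in>H. (1 / 2 ^ fst p) powr \<beta>) \<le> 2 * ennreal (2 * ?c * (\<epsilon> / t))"
        using G_sum[OF that] mult_left_mono[OF mass, of 2] by (auto intro: order_trans)
      also have "\<dots> = ennreal (4 * ?c * (\<epsilon> / t))"
        using ennreal_mult'[of 2 "2 * ?c * (\<epsilon> / t)"] by (simp add: mult.assoc)
      finally show ?thesis
        using mult_pos_pos[OF c et(1)] by (subst (asm) ennreal_le_iff) simp_all
    qed
    have "K \<subseteq> (\<Union>p\<in>G. halo p)"
      by (rule order_trans[OF G(2) UN_mono[OF order_refl cube_subset_halo]])
    then obtain H where H: "H \<subseteq> G" "finite H" "K \<subseteq> (\<Union>p\<in>H. halo p)"
      by (rule compactE_image[OF K(1) open_halo])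
    have good: "\<exists>y. ?M y \<le> ereal t \<and> (\<forall>i\<in>Basis. \<bar>2 ^ fst p * (y \<bullet> i) - of_int (snd p i)\<bar> \<le> 3)"
      if "p \<in> H" for p
    proof -
      obtain y where y: "y \<notin> U" "\<forall>i\<in>Basis. \<bar>2 ^ fst p * (y \<bullet> i) - of_int (snd p i)\<bar> \<le> 3"
        using G(4)[of p] H(1) \<open>p \<in> H\<close> by blast
      have "?M y \<le> \<bar>?M y\<bar>" by (cases "?M y") auto
      also have "\<dots> \<le> ereal t" using y(1) by (simp add: U_def not_less)
      finally show ?thesis using y(2) by blast
    qed
    have "0 \<le> t" using t by simp
    obtain u where u: "continuous_on UNIV u" "\<And>x. 0 \<le> u x" "\<And>x. u x \<le> 1" "\<And>x. x \<in> K \<Longrightarrow> u x = 1"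
      "\<And>x. u x \<noteq> 0 \<Longrightarrow> \<exists>p\<in>H. \<exists>z\<in>K. dist z x \<le> ?d * 3 * (1 / 2 ^ fst p)"
      "norm (signed_integral \<mu> (\<lambda>x. complex_of_real (u x))) \<le> A * t * (\<Sum>p\<in>H. (1 / 2 ^ fst p) powr \<beta>)"
      unfolding A_def
    proof (rule exists_cutoff[OF \<mu> F \<open>0 \<le> t\<close> H(2,3) _ good])
      show "cube p \<inter> K \<noteq> {}" if "p \<in> H" for p using G(3) H(1) that by blast
    qed (assumption, rule that[unfolded A_def])
    have "?d * 3 * (1 / 2 ^ fst p) \<le> \<delta>" if p: "p \<in> H" for p
    proof -
      have "(1 / 2 ^ fst p) powr \<beta> \<le> 4 * ?c * (\<epsilon> / t)"
        using sum_le[of "{p}"] subsetD[OF H(1) p] by simp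
      also have "\<dots> \<le> 4 * ?c * ((\<delta> / (3 * ?d)) powr \<beta> / (4 * ?c))"
        using et(2) \<epsilon>4 c by (intro mult_left_mono) auto
      also have "\<dots> = (\<delta> / (3 * ?d)) powr \<beta>" using c by simp
      finally have "1 / 2 ^ fst p \<le> \<delta> / (3 * ?d)"
        using \<beta>(1) \<delta> powr_less_mono2[of \<beta> "\<delta> / (3 * ?d)" "1 / 2 ^ fst p"] by (force simp: not_le[symmetric])
      then show ?thesis by (simp add: field_simps)
    qed
    then have "\<forall>x. u x \<noteq> 0 \<longrightarrow> (\<exists>z\<in>K. dist z x \<le> \<delta>)"
      using u(5) by (meson order_trans)
    moreover have "norm (signed_integral \<mu> (\<lambda>x. complex_of_real (u x))) \<le> \<delta>"
    proof -
      have "A * t * (\<Sum>p\<in>H. (1 / 2 ^ fst p) powr \<beta>) \<le> A * t * (4 * ?c * (\<epsilon> / t))"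
        using A t sum_le[OF H(2,1)] by (intro mult_left_mono) auto
      also have "\<dots> = 4 * A * ?c * \<epsilon>" using t by simp
      also have "\<dots> \<le> 4 * A * ?c * (\<delta> / (4 * A * ?c))"
        using A c \<epsilon>3 by (intro mult_left_mono) auto
      also have "\<dots> = \<delta>" using A c by simp
      finally show ?thesis using u(6) by linarith
    qed
    ultimately show ?thesis using u(1-4) by blast
  qed
  have "\<forall>n. \<exists>u. continuous_on UNIV u \<and> (\<forall>x. 0 \<le> u x \<and> u x \<le> 1) \<and> (\<forall>x\<in>K. u x = 1) \<and>
      (\<forall>x. u x \<noteq> 0 \<longrightarrow> (\<exists>z\<in>K. dist z x \<le> inverse (real (Suc n)))) \<and>
      norm (signed_integral \<mu> (\<lambda>x. complex_of_real (u x))) \<le> inverse (real (Suc n))"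
    by (intro allI approx) simp
  then obtain u where u: "\<And>n. continuous_on UNIV (u n)" "\<And>n x. 0 \<le> u n x \<and> u n x \<le> 1" "\<And>n x. x \<in> K \<Longrightarrow> u n x = 1"
      "\<And>n x. u n x \<noteq> 0 \<Longrightarrow> \<exists>z\<in>K. dist z x \<le> inverse (real (Suc n))"
      "\<And>n. norm (signed_integral \<mu> (\<lambda>x. complex_of_real (u n x))) \<le> inverse (real (Suc n))"
    by metis
  have "(\<lambda>n. u n x) \<longlonglongrightarrow> indicator K x" for x
  proof (cases "x \<in> K")
    case True
    then show ?thesis using u(3) by simp
  next
    case False
    then obtain e where e: "0 < e" "\<forall>z\<in>K. e \<le> dist x z"
      using separate_point_closed[OF compact_imp_closed[OF K(1)]] by blast
    obtain N where N: "inverse (real (Suc N)) < e" using reals_Archimedean[OF e(1)] by blast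
    have "u n x = 0" if "N \<le> n" for n
    proof (rule ccontr)
      assume "u n x \<noteq> 0"
      then obtain z where "z \<in> K" "dist z x \<le> inverse (real (Suc n))" using u(4) by blast
      moreover have "inverse (real (Suc n)) \<le> inverse (real (Suc N))" using that by (simp add: field_simps)
      moreover have "e \<le> dist z x" using e(2) \<open>z \<in> K\<close> by (subst dist_commute) simp
      ultimately show False using N by linarith
    qed
    then have "\<forall>\<^sub>F n in sequentially. u n x = indicator K x"
      using False by (auto simp: eventually_sequentially)
    then show ?thesis by (rule tendsto_eventually)
  qed
  then have "(\<lambda>n. signed_integral \<mu> (\<lambda>x. complex_of_real (u n x))) \<longlonglongrightarrow> complex_of_real (\<mu> K)"
    using u(1,2) by (intro signed_integral_tendsto_indicator \<mu> borel_compact K(1)) auto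
  moreover have "(\<lambda>n. signed_integral \<mu> (\<lambda>x. complex_of_real (u n x))) \<longlonglongrightarrow> 0"
    by (rule Lim_null_comparison[OF _ LIMSEQ_inverse_real_of_nat]) (use u(5) in auto)
  ultimately have "complex_of_real (\<mu> K) = 0" by (rule LIMSEQ_unique)
  then show ?thesis by simp
qed

lemma hausdorff_content_mono: "A \<subseteq> B \<Longrightarrow> hausdorff_content \<beta> A \<le> hausdorff_content \<beta> B"
  unfolding hausdorff_content_def by (rule INF_superset_mono) auto

theorem theorem7:
  fixes \<mu> :: "'a::euclidean_space set \<Rightarrow> real" and \<beta> :: real
  assumes "0 < \<beta>" and "\<beta> \<le> real DIM('a)"
    and "signed_measure \<mu>"
    and "\<exists>F. finite F \<and> grand_maximal F (real DIM('a) - \<beta>) (distribution_of \<mu>) \<in> L1_content \<beta>"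
  shows "lower_hausdorff_dim \<mu> \<ge> ennreal \<beta>"
proof -
  obtain F where F: "finite F"
    "choquet_integral \<beta> (grand_maximal F (real DIM('a) - \<beta>) (distribution_of \<mu>)) < \<infinity>"
    using assms(4) by (auto simp: L1_content_def)
  have "total_variation \<mu> E = 0" if E: "hausdorff_measure \<beta> E = 0" for E
  proof (rule total_variation_eq_0)
    fix A assume A: "A \<in> sets borel" "A \<subseteq> E"
    show "\<mu> A = 0"
    proof (rule signed_measure_eq_0_if_compact[OF assms(3) A(1)])
      fix K assume K: "compact K" "K \<subseteq> A"
      have "hausdorff_content \<beta> K \<le> hausdorff_content \<beta> E"
        using K(2) A(2) by (intro hausdorff_content_mono) auto
      then have "hausdorff_content \<beta> K = 0"
        using content_eq_0_if_hausdorff_measure_eq_0[OF assms(1) E] by simp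
      then show "\<mu> K = 0"
        by (intro compact_content_eq_0_imp_measure_eq_0[OF assms(1-3) F K(1)])
    qed
  qed
  then show ?thesis
    unfolding lower_hausdorff_dim_def using assms(1,2) by (intro SUP_upper) auto
qed

end
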